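(* Let $G$ be a $k$-regular graph of even order $n\ge 96$ and odd maximum multiplicity $r\ge 3$. Then the following statements hold. (a) If $k=rs\ge r(n/2+16)$ for some even integer $s$, then $G$ can be decomposed into $r-2$ perfect matchings, $(r+1)/2$ Hamilton cycles, one spanning $(s-1)$-regular simple graph, and $r-1$ spanning $(s-2)$-regular simple graphs. (b) If $k=rs\ge r(n/2+17)$ for some odd integer $s$, then $G$ can be decomposed into $2r-2$ perfect matchings, $(r+1)/2$ Hamilton cycles, one spanning $(s-2)$-regular simple graph, and $r-1$ spanning $(s-3)$-regular simple graphs.
   Context: Graphs are finite multigraphs: parallel edges are allowed, loops are not; a simple graph is one with no parallel edges. Degrees count parallel edges. The maximum multiplicity of $G$ is the largest number of edges joining two vertices of $G$. A decomposition of $G$ into subgraphs is a collection of pairwise edge-disjoint subgraphs of $G$ whose edge sets partition $E(G)$. *)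

theory Defs
  imports Complex_Main
begin

record ('v, 'e) pre_multigraph =
  verts :: "'v set"
  edges :: "'e set"
  ends :: "'e \<Rightarrow> 'v set"

text \<open>Edges have an identity of their own, so parallel edges are distinct edges with the same
  set of ends; that every edge has exactly two ends excludes loops.\<close>

locale multigraph =
  fixes G :: "('v, 'e) pre_multigraph"
  assumes finite_verts: "finite (verts G)"
    and finite_edges: "finite (edges G)"
    and ends_subset: "e \<in> edges G \<Longrightarrow> ends G e \<subseteq> verts G"
    and card_ends: "e \<in> edges G \<Longrightarrow> card (ends G e) = 2"

definition order :: "('v, 'e) pre_multigraph \<Rightarrow> nat" where
  "order G = card (verts G)"

definition degree :: "('v, 'e) pre_multigraph \<Rightarrow> 'v \<Rightarrow> nat" where
  "degree G v = card {e \<in> edges G. v \<in> ends G e}"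

definition regular :: "nat \<Rightarrow> ('v, 'e) pre_multigraph \<Rightarrow> bool" where
  "regular k G \<longleftrightarrow> (\<forall>v \<in> verts G. degree G v = k)"

definition multiplicity :: "('v, 'e) pre_multigraph \<Rightarrow> 'v \<Rightarrow> 'v \<Rightarrow> nat" where
  "multiplicity G u v = card {e \<in> edges G. ends G e = {u, v}}"

text \<open>Meaningful only for graphs with at least two vertices.\<close>

definition max_multiplicity :: "('v, 'e) pre_multigraph \<Rightarrow> nat" where
  "max_multiplicity G =
     Max {multiplicity G u v | u v. u \<in> verts G \<and> v \<in> verts G \<and> u \<noteq> v}"

definition simple :: "('v, 'e) pre_multigraph \<Rightarrow> bool" where
  "simple G \<longleftrightarrow> inj_on (ends G) (edges G)"

definition subgraph :: "('v, 'e) pre_multigraph \<Rightarrow> ('v, 'e) pre_multigraph \<Rightarrow> bool" where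
  "subgraph H G \<longleftrightarrow> multigraph H \<and> verts H \<subseteq> verts G \<and> edges H \<subseteq> edges G \<and>
     (\<forall>e \<in> edges H. ends H e = ends G e)"

definition spanning_subgraph :: "('v, 'e) pre_multigraph \<Rightarrow> ('v, 'e) pre_multigraph \<Rightarrow> bool" where
  "spanning_subgraph H G \<longleftrightarrow> subgraph H G \<and> verts H = verts G"

definition perfect_matching :: "('v, 'e) pre_multigraph \<Rightarrow> ('v, 'e) pre_multigraph \<Rightarrow> bool" where
  "perfect_matching M G \<longleftrightarrow> spanning_subgraph M G \<and>
     (\<forall>e \<in> edges M. \<forall>f \<in> edges M. e \<noteq> f \<longrightarrow> ends M e \<inter> ends M f = {}) \<and>
     (\<Union>e \<in> edges M. ends M e) = verts G"

text \<open>Two vertices joined by two parallel edges form a cycle of length 2.\<close>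

definition cycle :: "('v, 'e) pre_multigraph \<Rightarrow> bool" where
  "cycle C \<longleftrightarrow> (\<exists>vs es. length vs \<ge> 2 \<and> length es = length vs \<and> distinct vs \<and> distinct es \<and>
     verts C = set vs \<and> edges C = set es \<and>
     (\<forall>i < length vs. ends C (es ! i) = {vs ! i, vs ! (Suc i mod length vs)}))"

definition hamilton_cycle :: "('v, 'e) pre_multigraph \<Rightarrow> ('v, 'e) pre_multigraph \<Rightarrow> bool" where
  "hamilton_cycle C G \<longleftrightarrow> spanning_subgraph C G \<and> cycle C"

definition decomposition :: "('v, 'e) pre_multigraph \<Rightarrow> ('v, 'e) pre_multigraph list \<Rightarrow> bool" where
  "decomposition G Hs \<longleftrightarrow> (\<forall>H \<in> set Hs. subgraph H G) \<and>
     (\<forall>i < length Hs. \<forall>j < length Hs. i \<noteq> j \<longrightarrow> edges (Hs ! i) \<inter> edges (Hs ! j) = {}) \<and>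
     (\<Union>H \<in> set Hs. edges H) = edges G"

end

theory Submission
  imports Defs
begin

text \<open>Everything takes place on the multiplicities of the vertex pairs. The basic step splits a
  digraph in which all in- and out-degrees equal \<open>\<sigma>\<close>: its underlying multigraph has multiplicity at
  most two. Let \<open>Q1\<close> and \<open>Q2\<close> be the single and the double pairs. Since the single arcs are balanced,
  \<open>Q1\<close> has a spanning forest whose degree at \<open>v\<close> is at most one more than half the \<open>Q1\<close>-degree, so that
  even after deleting the forest the pairs satisfy Dirac's condition and contain a Hamilton cycle \<open>H\<close>. Once
  \<open>H\<close> is removed, the single pairs are those of the symmetric difference of \<open>Q1\<close> and \<open>H\<close>, a connected
  graph with even degrees and an even number of edges. Colouring an Euler circuit alternately
  halves it, which leaves two \<open>(\<sigma> - 1)\<close>-regular simple graphs.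

  Rounding \<open>1/r\<close> of the multigraph, with every pair in both directions, yields such a digraph with
  \<open>\<sigma> = s\<close> that contains all pairs of multiplicity \<open>r\<close> twice; \<open>H\<close> and one of the two simple graphs then
  reduce the maximum multiplicity to at most the even number \<open>r - 1\<close>. After removal of some perfect matchings,
  an Eulerian orientation and bipartite rounding split the rest into digraphs to which the basic
  step applies.\<close>

text \<open>The additive constants count lost degree. A vertex in at most 14 forbidden double pairs
  keeps underlying degree at least \<open>\<sigma> - 15\<close> once the forest is reserved, so
  Dirac's bound asks for \<open>card V + 30 \<le> 2 * \<sigma>\<close>; the few other vertices are
  tolerated by the closure argument. The later digraphs have \<open>\<sigma> = s - 1\<close>, which
  turns 30 into 32, that is \<open>s \<ge> n/2 + 16\<close>. In (b), \<open>r\<close> matchings are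
  removed beforehand, \<open>s - 1\<close> takes the place of \<open>s\<close>, and 16 becomes 17.
  The obstacle in the basic step is exact halving. Alternate colouring balances every vertex,
  including the start of the circuit, only if the circuit has even length; with several components,
  each one of odd size would spoil a vertex. The reserved forest keeps the graph in one piece, and
  then only the total number of edges matters, which is even because \<open>card V\<close> is. The
  forest must also be cheap: an arbitrary spanning forest could use all single pairs at a vertex,
  whereas one grown along the arcs uses about half of them.\<close>

section \<open>Simple graphs as sets of two-element vertex sets\<close>

definition pairs :: "'v set \<Rightarrow> 'v set set" where
  "pairs V = {p. p \<subseteq> V \<and> card p = 2}"

definition vdeg :: "'v set set \<Rightarrow> 'v \<Rightarrow> nat" where
  "vdeg P v = card {p \<in> P. v \<in> p}"

lemma pair_in_pairs [simp]: "{u, v} \<in> pairs V \<longleftrightarrow> u \<in> V \<and> v \<in> V \<and> u \<noteq> v"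
  by (auto simp: pairs_def card_insert_if)

lemma singleton_notin_pairs [simp]: "{u} \<notin> pairs V"
  by (simp add: pairs_def)

lemma pairsE:
  assumes "p \<in> pairs V"
  obtains u v where "p = {u, v}" "u \<in> V" "v \<in> V" "u \<noteq> v"
  using assms by (auto simp: pairs_def card_2_iff)

lemma finite_pairs: "finite V \<Longrightarrow> finite (pairs V)"
  by (rule finite_subset[of _ "Pow V"]) (auto simp: pairs_def)

lemma finite_pairs_subset: "finite V \<Longrightarrow> P \<subseteq> pairs V \<Longrightarrow> finite P"
  using finite_pairs finite_subset by blast

lemma star_eq:
  assumes "v \<in> V"
  shows "{p \<in> pairs V. v \<in> p} = (\<lambda>u. {v, u}) ` (V - {v})"
proof (intro set_eqI iffI)
  fix p assume p: "p \<in> {p \<in> pairs V. v \<in> p}"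
  then have "p \<in> pairs V" by blast
  then obtain a b where "p = {a, b}" "a \<in> V" "b \<in> V" "a \<noteq> b" by (rule pairsE)
  then show "p \<in> (\<lambda>u. {v, u}) ` (V - {v})"
    using p by (cases "v = a") (auto simp: insert_commute)
qed (use assms in auto)

lemma inj_on_pair: "inj_on (\<lambda>u. {v, u}) A"
  by (auto simp: inj_on_def doubleton_eq_iff)

lemma sum_star:
  assumes "v \<in> V"
  shows "(\<Sum>p | p \<in> pairs V \<and> v \<in> p. f p) = (\<Sum>u\<in>V - {v}. f {v, u})"
  by (subst star_eq[OF assms]) (simp add: sum.reindex[OF inj_on_pair])

lemma vdeg_nb:
  assumes "P \<subseteq> pairs V"
  shows "vdeg P v = card {u. {v, u} \<in> P}"
proof -
  have "{p \<in> P. v \<in> p} = (\<lambda>u. {v, u}) ` {u. {v, u} \<in> P}"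
  proof (intro set_eqI iffI)
    fix p assume p: "p \<in> {p \<in> P. v \<in> p}"
    then have "p \<in> pairs V" using assms by blast
    then obtain a b where ab: "p = {a, b}" by (rule pairsE)
    then have "p = {v, a} \<or> p = {v, b}" using p by auto
    then show "p \<in> (\<lambda>u. {v, u}) ` {u. {v, u} \<in> P}" using p by auto
  qed auto
  then show ?thesis
    by (simp add: vdeg_def card_image[OF inj_on_pair])
qed

lemma vdeg_union:
  assumes "finite P" "finite Q" "P \<inter> Q = {}"
  shows "vdeg (P \<union> Q) v = vdeg P v + vdeg Q v"
proof -
  have "{p \<in> P \<union> Q. v \<in> p} = {p \<in> P. v \<in> p} \<union> {p \<in> Q. v \<in> p}" by blast
  moreover have "card \<dots> = vdeg P v + vdeg Q v"
    unfolding vdeg_def using assms by (intro card_Un_disjoint) auto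
  ultimately show ?thesis by (simp add: vdeg_def)
qed

lemma vdeg_diff:
  assumes "finite P" "Q \<subseteq> P"
  shows "vdeg (P - Q) v = vdeg P v - vdeg Q v" "vdeg Q v \<le> vdeg P v"
proof -
  have "vdeg ((P - Q) \<union> Q) v = vdeg (P - Q) v + vdeg Q v"
    using assms by (intro vdeg_union) (auto intro: finite_subset)
  moreover have "(P - Q) \<union> Q = P" using assms by blast
  ultimately show "vdeg (P - Q) v = vdeg P v - vdeg Q v" "vdeg Q v \<le> vdeg P v" by simp_all
qed

lemma handshake:
  assumes "finite V" "P \<subseteq> pairs V"
  shows "(\<Sum>v\<in>V. vdeg P v) = 2 * card P"
proof -
  have fP: "finite P" using finite_pairs_subset[OF assms] .
  have "(\<Sum>v\<in>V. vdeg P v) = (\<Sum>v\<in>V. \<Sum>p\<in>P. if v \<in> p then 1 else 0)"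
    using fP by (simp add: vdeg_def sum.If_cases Int_def)
  also have "\<dots> = (\<Sum>p\<in>P. \<Sum>v\<in>V. if v \<in> p then 1 else 0)" by (rule sum.swap)
  also have "\<dots> = (\<Sum>p\<in>P. 2)"
  proof (rule sum.cong[OF refl])
    fix p assume "p \<in> P"
    then have "p \<subseteq> V" "card p = 2" using assms by (auto simp: pairs_def)
    then have "V \<inter> {v. v \<in> p} = p" by blast
    then show "(\<Sum>v\<in>V. if v \<in> p then 1 else 0) = (2::nat)"
      using assms \<open>card p = 2\<close> by (simp add: sum.If_cases)
  qed
  finally show ?thesis by simp
qed

definition cycle_edges :: "'v list \<Rightarrow> 'v set set" where
  "cycle_edges vs = (\<lambda>i. {vs ! i, vs ! (Suc i mod length vs)}) ` {..<length vs}"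

text \<open>Length two is excluded because both edges of such a cycle are the same pair, which a set
  of pairs cannot record twice.\<close>

definition ham :: "'v set \<Rightarrow> 'v set set \<Rightarrow> bool" where
  "ham V C \<longleftrightarrow> (\<exists>vs. distinct vs \<and> set vs = V \<and> 3 \<le> length vs \<and> C = cycle_edges vs)"

lemma cycle_edges_subset:
  assumes "successively (\<lambda>x y. {x, y} \<in> E) vs" "{last vs, hd vs} \<in> E"
  shows "cycle_edges vs \<subseteq> E"
proof (cases "vs = []")
  case False
  show ?thesis
  proof
    fix p assume "p \<in> cycle_edges vs"
    then obtain i where i: "i < length vs" "p = {vs ! i, vs ! (Suc i mod length vs)}"
      by (auto simp: cycle_edges_def)
    show "p \<in> E"
    proof (cases "Suc i < length vs")
      case True
      then show ?thesis using assms(1) i by (simp add: successively_conv_nth)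
    next
      case F: False
      then have "Suc i = length vs" using i by simp
      then have "i = length vs - 1" by simp
      then show ?thesis using assms(2) i F False by (simp add: last_conv_nth hd_conv_nth)
    qed
  qed
qed (simp add: cycle_edges_def)

text \<open>Allows a Hamilton cycle to be cut open at any prescribed edge.\<close>

lemma cycle_edges_rotate_subset: "cycle_edges (rotate k vs) \<subseteq> cycle_edges vs"
proof
  fix p assume "p \<in> cycle_edges (rotate k vs)"
  then obtain i where i: "i < length vs"
      "p = {rotate k vs ! i, rotate k vs ! (Suc i mod length vs)}"
    by (auto simp: cycle_edges_def)
  let ?n = "length vs"
  have n: "0 < ?n" using i(1) by (cases vs) auto
  then have "Suc i mod ?n < ?n" by simp
  then have "p = {vs ! ((k + i) mod ?n), vs ! ((k + Suc i mod ?n) mod ?n)}"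
    using i by (simp add: nth_rotate)
  also have "(k + Suc i mod ?n) mod ?n = Suc ((k + i) mod ?n) mod ?n"
    by (simp add: mod_simps)
  finally show "p \<in> cycle_edges vs"
    using n by (auto simp: cycle_edges_def)
qed

subsection \<open>Hamilton cycles\<close>

text \<open>Crossing chords: if the first vertex is adjacent to position \<open>i + 1\<close> and
  the last one to position \<open>i\<close>, the path closes up after its tail beyond
  \<open>i\<close> is reversed. Such an \<open>i\<close> exists by pigeonhole, as only
  \<open>length vs - 1\<close> positions compete for at least \<open>length vs\<close>
  adjacencies.\<close>

lemma ham_close_path:
  assumes vs: "distinct vs" "set vs = V" "3 \<le> length vs"
    and E: "E \<subseteq> pairs V"
    and path: "successively (\<lambda>x y. {x, y} \<in> E) vs"
    and deg: "card V \<le> vdeg E (hd vs) + vdeg E (last vs)"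
  shows "\<exists>C. ham V C \<and> C \<subseteq> E"
proof -
  let ?n = "length vs"
  have n: "card V = ?n" using vs distinct_card by blast
  have "vs \<noteq> []" using vs(3) by auto
  then have hd: "hd vs = vs ! 0" and la: "last vs = vs ! (?n - 1)"
    by (simp_all add: hd_conv_nth last_conv_nth)
  have idx: "\<exists>i<?n. u = vs ! i" if "{v, u} \<in> E" for u v
  proof -
    from that E have "u \<in> set vs" using vs by auto
    then show ?thesis by (metis in_set_conv_nth)
  qed
  define A where "A = {i. i < ?n - 1 \<and> {hd vs, vs ! Suc i} \<in> E}"
  define B where "B = {i. i < ?n - 1 \<and> {last vs, vs ! i} \<in> E}"
  have inj: "inj_on (\<lambda>i. vs ! Suc i) A" "inj_on (\<lambda>i. vs ! i) B"
    using vs by (auto simp: inj_on_def A_def B_def nth_eq_iff_index_eq)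
  have "{u. {hd vs, u} \<in> E} = (\<lambda>i. vs ! Suc i) ` A"
  proof (intro set_eqI iffI)
    fix u assume u: "u \<in> {u. {hd vs, u} \<in> E}"
    then obtain i where i: "i < ?n" "u = vs ! i" using idx by blast
    have "u \<noteq> hd vs" using u subsetD[OF E] by fastforce
    then obtain j where "i = Suc j" using i hd by (cases i) auto
    then show "u \<in> (\<lambda>i. vs ! Suc i) ` A" using i u by (auto simp: A_def)
  qed (auto simp: A_def)
  then have dA: "vdeg E (hd vs) = card A"
    using inj by (simp add: vdeg_nb[OF E] card_image)
  have "{u. {last vs, u} \<in> E} = (\<lambda>i. vs ! i) ` B"
  proof (intro set_eqI iffI)
    fix u assume u: "u \<in> {u. {last vs, u} \<in> E}"
    then obtain i where i: "i < ?n" "u = vs ! i" using idx by blast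
    have "u \<noteq> last vs" using u subsetD[OF E] by fastforce
    then have "i \<noteq> ?n - 1" using i la by auto
    then show "u \<in> (\<lambda>i. vs ! i) ` B" using i u by (auto simp: B_def)
  qed (auto simp: B_def)
  then have dB: "vdeg E (last vs) = card B"
    using inj by (simp add: vdeg_nb[OF E] card_image)
  have sub: "A \<subseteq> {..<?n - 1}" "B \<subseteq> {..<?n - 1}" by (auto simp: A_def B_def)
  have "A \<inter> B \<noteq> {}"
  proof
    assume "A \<inter> B = {}"
    then have "card (A \<union> B) = card A + card B"
      using sub by (meson card_Un_disjoint finite_lessThan finite_subset)
    moreover have "card (A \<union> B) \<le> ?n - 1"
      using card_mono[of "{..<?n - 1}" "A \<union> B"] sub by auto
    ultimately show False using deg dA dB n vs by linarith
  qed
  then obtain i where i: "i < ?n - 1" "{hd vs, vs ! Suc i} \<in> E" "{last vs, vs ! i} \<in> E"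
    by (auto simp: A_def B_def)
  define a where "a = take (Suc i) vs"
  define b where "b = drop (Suc i) vs"
  have ab: "vs = a @ b" "a \<noteq> []" "b \<noteq> []"
    using i by (auto simp: a_def b_def)
  have lh: "hd a = hd vs" "last b = last vs" "hd b = vs ! Suc i" "last a = vs ! i"
  proof -
    show "hd a = hd vs" using ab(1,2) by (metis hd_append2)
    show "last b = last vs" using ab(1,3) by (metis last_appendR)
    show "hd b = vs ! Suc i" using i by (simp add: b_def hd_drop_conv_nth)
    show "last a = vs ! i" using i by (simp add: a_def take_Suc_conv_app_nth)
  qed
  have sym: "(\<lambda>x y. {y, x} \<in> E) = (\<lambda>x y. {x, y} \<in> E)"
    by (simp add: insert_commute)
  have "successively (\<lambda>x y. {x, y} \<in> E) (a @ b)" using path ab(1) by simp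
  then have "successively (\<lambda>x y. {x, y} \<in> E) (a @ rev b)"
    unfolding successively_append_iff successively_rev sym
    using ab(2,3) i(3) lh by (simp add: hd_rev) (metis insert_commute)
  moreover have "{last (a @ rev b), hd (a @ rev b)} \<in> E"
    using ab(2,3) lh i(2) by (simp add: last_rev) (metis insert_commute)
  ultimately have "cycle_edges (a @ rev b) \<subseteq> E" by (rule cycle_edges_subset)
  moreover have "ham V (cycle_edges (a @ rev b))"
    unfolding ham_def using vs ab by (intro exI[of _ "a @ rev b"]) auto
  ultimately show ?thesis by blast
qed

text \<open>The closure argument of Bondy and Chvatal: in an edge-maximal graph without a
  Hamilton cycle, non-adjacent vertices have degree sum less than the order.\<close>

theorem ham_exists:
  assumes fin: "finite V" and n: "3 \<le> card V" and E: "E \<subseteq> pairs V"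
    and X: "X \<subseteq> V" "2 * card X \<le> card V"
    and deg: "\<And>v. v \<in> V - X \<Longrightarrow> card V \<le> 2 * vdeg E v"
    and degX: "\<And>v. v \<in> X \<Longrightarrow> card X < vdeg E v"
  shows "\<exists>C. ham V C \<and> C \<subseteq> E"
proof (rule ccontr)
  assume no: "\<not> ?thesis"
  define P where "P F \<longleftrightarrow> E \<subseteq> F \<and> F \<subseteq> pairs V \<and> \<not> (\<exists>C. ham V C \<and> C \<subseteq> F)" for F
  have PE: "P E" using no E by (simp add: P_def)
  have fp: "finite (pairs V)" using fin by (rule finite_pairs)
  have "\<forall>F. P F \<longrightarrow> card F < Suc (card (pairs V))"
    using fp by (simp add: P_def card_mono le_imp_less_Suc)
  then have "\<exists>F. P F \<and> (\<forall>F'. P F' \<longrightarrow> card F' \<le> card F)"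
    by (rule ex_has_greatest_nat[of P E card, OF PE])
  then obtain F where F: "P F" and max: "\<And>F'. P F' \<Longrightarrow> card F' \<le> card F" by blast
  have Fp: "F \<subseteq> pairs V" and EF: "E \<subseteq> F" and noF: "\<not> (\<exists>C. ham V C \<and> C \<subseteq> F)"
    using F by (auto simp: P_def)
  have fF: "finite F" using Fp fp finite_subset by blast
  have fX: "finite X" using X fin finite_subset by blast
  have mono: "vdeg E v \<le> vdeg F v" for v
    unfolding vdeg_def using EF fF by (intro card_mono) auto
  have nonadj: "vdeg F u + vdeg F v < card V"
    if uv: "u \<in> V" "v \<in> V" "u \<noteq> v" "{u, v} \<notin> F" for u v
  proof (rule ccontr)
    assume ge: "\<not> vdeg F u + vdeg F v < card V"
    \<comment> \<open>By maximality the extra edge creates a Hamilton cycle, which must use it;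
      removing the edge leaves a Hamilton path in \<open>F\<close> from \<open>u\<close> to
      \<open>v\<close>, to which the chord argument applies.\<close>
    have "card (insert {u, v} F) = Suc (card F)" using fF uv by simp
    then have "\<not> P (insert {u, v} F)" using max by fastforce
    then obtain C where C: "ham V C" "C \<subseteq> insert {u, v} F"
      using uv Fp EF by (auto simp: P_def)
    then have uvC: "{u, v} \<in> C" using noF by blast
    from C obtain vs where vs: "distinct vs" "set vs = V" "3 \<le> length vs" "C = cycle_edges vs"
      by (auto simp: ham_def)
    obtain i where i: "i < length vs" "{u, v} = {vs ! i, vs ! (Suc i mod length vs)}"
      using uvC vs by (auto simp: cycle_edges_def)
    let ?n = "length vs"
    \<comment> \<open>Rotated so that \<open>{u, v}\<close> is the closing edge; as the length is at
      least 3, no other consecutive pair equals it.\<close>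
    define ws where "ws = rotate (Suc i) vs"
    have ne: "vs \<noteq> []" using vs by auto
    have lw: "length ws = ?n" by (simp add: ws_def)
    have hd: "hd ws = vs ! (Suc i mod ?n)"
      using ne unfolding ws_def by (rule hd_rotate_conv_nth)
    have la: "last ws = vs ! i"
    proof -
      have "last ws = ws ! (?n - 1)" using ne lw by (subst last_conv_nth) auto
      also have "\<dots> = vs ! ((Suc i + (?n - 1)) mod ?n)"
        unfolding ws_def using vs by (subst nth_rotate) auto
      also have "Suc i + (?n - 1) = i + ?n" using vs by simp
      finally show ?thesis using i by simp
    qed
    have "set ws = V" "distinct ws" using vs by (auto simp: ws_def)
    have sub: "cycle_edges ws \<subseteq> insert {u, v} F"
      using cycle_edges_rotate_subset[of "Suc i" vs] C vs by (auto simp: ws_def)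
    have "successively (\<lambda>x y. {x, y} \<in> F) ws"
      unfolding successively_conv_nth
    proof (intro allI impI)
      fix j assume j: "Suc j < length ws"
      then have "{ws ! j, ws ! Suc j} \<in> cycle_edges ws"
        unfolding cycle_edges_def by (intro image_eqI[of _ _ j]) auto
      moreover have "{ws ! j, ws ! Suc j} \<noteq> {u, v}"
      proof
        assume eq: "{ws ! j, ws ! Suc j} = {u, v}"
        have "ws \<noteq> []" using ne lw by auto
        then have "hd ws = ws ! 0" "last ws = ws ! (?n - 1)"
          using lw by (simp_all add: hd_conv_nth last_conv_nth)
        then have "{ws ! j, ws ! Suc j} = {ws ! (?n - 1), ws ! 0}"
          unfolding eq i(2) hd[symmetric] la[symmetric] by simp
        moreover have "ws ! Suc j \<noteq> ws ! 0" "ws ! j = ws ! 0 \<Longrightarrow> ws ! Suc j \<noteq> ws ! (?n - 1)"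
          using j vs(3) lw nth_eq_iff_index_eq[OF \<open>distinct ws\<close>, of "Suc j" 0]
            nth_eq_iff_index_eq[OF \<open>distinct ws\<close>, of j 0]
            nth_eq_iff_index_eq[OF \<open>distinct ws\<close>, of "Suc j" "?n - 1"] by linarith+
        ultimately show False by (auto simp: doubleton_eq_iff)
      qed
      ultimately show "{ws ! j, ws ! Suc j} \<in> F" using sub by blast
    qed
    moreover have "card V \<le> vdeg F (hd ws) + vdeg F (last ws)"
      using ge hd la i by (auto simp: doubleton_eq_iff)
    ultimately have "\<exists>C. ham V C \<and> C \<subseteq> F"
      using ham_close_path[of ws V F] \<open>set ws = V\<close> \<open>distinct ws\<close> vs Fp by (simp add: ws_def)
    with noF show False by blast
  qed
  \<comment> \<open>\<open>F\<close> is shown to be complete in three rounds. \<open>V - X\<close>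
    is a clique, so its vertices have degree at least \<open>card V - card X - 1\<close>; this and
    \<open>degX\<close> join \<open>X\<close> to all of \<open>V - X\<close>; then vertices of
    \<open>X\<close> have degree at least \<open>card V - card X\<close>, which is at least half of
    \<open>card V\<close>, and are adjacent to each other.\<close>
  have adj1: "{u, v} \<in> F" if "u \<in> V - X" "v \<in> V - X" "u \<noteq> v" for u v
    using nonadj[of u v] deg[OF that(1)] deg[OF that(2)] mono[of u] mono[of v] that by fastforce
  have big: "card V \<le> Suc (card X + vdeg F u)" if u: "u \<in> V - X" for u
  proof -
    have "V - X - {u} \<subseteq> {w. {u, w} \<in> F}" using adj1[OF u] by auto
    moreover have "finite {w. {u, w} \<in> F}"
      by (rule finite_subset[OF _ fin]) (use Fp in auto)
    ultimately have "card (V - X - {u}) \<le> vdeg F u"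
      by (simp add: vdeg_nb[OF Fp] card_mono)
    moreover have "card (V - X - {u}) = card V - card X - 1"
      using u fin fX X by (simp add: card_Diff_subset)
    ultimately show ?thesis by linarith
  qed
  have adj2: "{x, u} \<in> F" if "x \<in> X" "u \<in> V - X" for x u
    using nonadj[of x u] big[OF that(2)] degX[OF that(1)] mono[of x] that X by fastforce
  have adj3: "{x, y} \<in> F" if xy: "x \<in> X" "y \<in> X" "x \<noteq> y" for x y
  proof (rule ccontr)
    assume "{x, y} \<notin> F"
    then have "vdeg F x + vdeg F y < card V" using nonadj xy X by blast
    moreover have big': "card V - card X \<le> vdeg F z" if z: "z \<in> X" for z
    proof -
      have "V - X \<subseteq> {w. {z, w} \<in> F}" using adj2[OF z] by auto
      moreover have "finite {w. {z, w} \<in> F}"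
        by (rule finite_subset[OF _ fin]) (use Fp in auto)
      ultimately show ?thesis
        using X fX by (simp add: vdeg_nb[OF Fp] card_mono card_Diff_subset[symmetric])
    qed
    ultimately show False using big'[OF xy(1)] big'[OF xy(2)] X(2) by linarith
  qed
  have all: "{u, v} \<in> F" if "u \<in> V" "v \<in> V" "u \<noteq> v" for u v
  proof -
    have "{u, v} = {v, u}" by (rule insert_commute)
    then show ?thesis using that adj1[of u v] adj2[of u v] adj2[of v u] adj3[of u v] by auto
  qed
  obtain vs where vs: "set vs = V" "distinct vs" using finite_distinct_list[OF fin] by blast
  then have len: "3 \<le> length vs" using n distinct_card by fastforce
  have "cycle_edges vs \<subseteq> F"
  proof (rule cycle_edges_subset)
    show "successively (\<lambda>x y. {x, y} \<in> F) vs"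
      unfolding successively_conv_nth
      using vs by (auto intro!: all simp: nth_eq_iff_index_eq)
    show "{last vs, hd vs} \<in> F"
    proof (rule all)
      show "last vs \<noteq> hd vs"
        using len vs by (cases vs) auto
    next
      have "vs \<noteq> []" using len by auto
      then show "last vs \<in> V" "hd vs \<in> V" using vs by auto
    qed
  qed
  then show False using noF vs len by (auto simp: ham_def)
qed

lemma ham_dirac:
  assumes "finite V" "3 \<le> card V" "E \<subseteq> pairs V" "\<And>v. v \<in> V \<Longrightarrow> card V \<le> 2 * vdeg E v"
  shows "\<exists>C. ham V C \<and> C \<subseteq> E"
  using ham_exists[of V E "{}"] assms by auto

text \<open>Two positions giving the same pair would be successors of each other, which only happens
  in length 2.\<close>

lemma inj_on_cycle_edges:
  assumes "distinct vs" "3 \<le> length vs"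
  shows "inj_on (\<lambda>i. {vs ! i, vs ! (Suc i mod length vs)}) {..<length vs}"
proof (rule inj_onI)
  fix i j assume *: "i \<in> {..<length vs}" "j \<in> {..<length vs}"
    "{vs ! i, vs ! (Suc i mod length vs)} = {vs ! j, vs ! (Suc j mod length vs)}"
  have lt: "Suc i mod length vs < length vs" "Suc j mod length vs < length vs"
    using assms by (intro mod_less_divisor; linarith)+
  from * lt assms(1) have "i = j \<or> (i = Suc j mod length vs \<and> Suc i mod length vs = j)"
    by (auto simp: doubleton_eq_iff nth_eq_iff_index_eq)
  moreover have "\<not> (i = Suc j mod length vs \<and> Suc i mod length vs = j)"
  proof
    assume "i = Suc j mod length vs \<and> Suc i mod length vs = j"
    then show False using * assms(2)
      by (cases "Suc j = length vs"; cases "Suc i = length vs") auto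
  qed
  ultimately show "i = j" by blast
qed

lemma ham_facts:
  assumes "ham V C" "finite V"
  shows "C \<subseteq> pairs V" "card C = card V" "\<And>v. v \<in> V \<Longrightarrow> vdeg C v = 2"
    "u \<in> V \<Longrightarrow> v \<in> V \<Longrightarrow> (u, v) \<in> {(a, b). {a, b} \<in> C}\<^sup>*"
    "even (card V) \<Longrightarrow> \<exists>M\<subseteq>C. \<forall>v\<in>V. vdeg M v = 1"
proof -
  obtain vs where vs: "distinct vs" "set vs = V" "3 \<le> length vs" "C = cycle_edges vs"
    using assms by (auto simp: ham_def)
  let ?n = "length vs"
  let ?e = "\<lambda>i. {vs ! i, vs ! (Suc i mod ?n)}"
  have n: "card V = ?n" using vs distinct_card by blast
  have inj: "inj_on ?e {..<?n}" using inj_on_cycle_edges vs by blast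
  have mlt: "i mod ?n < ?n" for i using vs by (intro mod_less_divisor) linarith
  show sub: "C \<subseteq> pairs V"
  proof
    fix p assume "p \<in> C"
    then obtain i where i: "i < ?n" "p = ?e i" using vs by (auto simp: cycle_edges_def)
    have "i \<noteq> Suc i mod ?n" using i vs by (cases "Suc i = ?n") auto
    then show "p \<in> pairs V" using i vs mlt by (auto simp: nth_eq_iff_index_eq)
  qed
  show "card C = card V" using inj vs n by (simp add: cycle_edges_def card_image)
  \<comment> \<open>Vertices are indexed as successors, so that the two edges at a vertex are
    \<open>j\<close> and \<open>Suc j mod ?n\<close> and no predecessor modulo \<open>?n\<close> is
    needed. The index set \<open>I\<close> serves both the whole cycle and its even
    positions.\<close>
  have star: "{p \<in> ?e ` I. vs ! (Suc j mod ?n) \<in> p} = ?e ` (I \<inter> {j, Suc j mod ?n})"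
    if "I \<subseteq> {..<?n}" "j < ?n" for I j
  proof -
    have "vs ! (Suc j mod ?n) \<in> ?e i \<longleftrightarrow> i = j \<or> i = Suc j mod ?n" if i: "i < ?n" for i
    proof -
      have "vs ! (Suc j mod ?n) \<in> ?e i \<longleftrightarrow> Suc j mod ?n = i \<or> Suc j mod ?n = Suc i mod ?n"
        using vs i mlt by (auto simp: nth_eq_iff_index_eq)
      moreover have "Suc j mod ?n = Suc i mod ?n \<longleftrightarrow> i = j"
        using i \<open>j < ?n\<close> by (cases "Suc i = ?n"; cases "Suc j = ?n") auto
      ultimately show ?thesis by auto
    qed
    then show ?thesis using that by auto
  qed
  have pre: "\<exists>j<?n. v = vs ! (Suc j mod ?n)" if v: "v \<in> V" for v
  proof -
    obtain k where k: "k < ?n" "v = vs ! k" using v vs by (metis in_set_conv_nth)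
    show ?thesis
    proof (cases k)
      case 0
      then show ?thesis using k by (intro exI[of _ "?n - 1"]) auto
    next
      case (Suc j)
      then show ?thesis using k by (intro exI[of _ j]) auto
    qed
  qed
  have neq: "j \<noteq> Suc j mod ?n" if "j < ?n" for j using that vs by (cases "Suc j = ?n") auto
  show "vdeg C v = 2" if v: "v \<in> V" for v
  proof -
    obtain j where j: "j < ?n" "v = vs ! (Suc j mod ?n)" using pre[OF v] by blast
    have "{p \<in> C. v \<in> p} = ?e ` {j, Suc j mod ?n}"
      using star[of "{..<?n}" j] j mlt vs by (simp add: cycle_edges_def Int_absorb1)
    moreover have "card (?e ` {j, Suc j mod ?n}) = card {j, Suc j mod ?n}"
      by (intro card_image inj_on_subset[OF inj]) (use j mlt in auto)
    ultimately show ?thesis using neq[OF j(1)] by (simp add: vdeg_def)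
  qed
  show "\<exists>M\<subseteq>C. \<forall>v\<in>V. vdeg M v = 1" if ev: "even (card V)"
  proof (intro exI conjI ballI)
    let ?I = "{i. i < ?n \<and> even i}"
    show "?e ` ?I \<subseteq> C" using vs by (auto simp: cycle_edges_def)
    fix v assume v: "v \<in> V"
    obtain j where j: "j < ?n" "v = vs ! (Suc j mod ?n)" using pre[OF v] by blast
    \<comment> \<open>Since the length is even, parity alternates also across the wrap-around, and
      exactly one of the two edges at a vertex has even index.\<close>
    have "even (Suc j mod ?n) \<longleftrightarrow> odd j"
    proof (cases "Suc j = ?n")
      case True
      then have "even (Suc j)" using ev n by simp
      then have "odd j" by simp
      then show ?thesis using True by simp
    next
      case False
      then show ?thesis using j by simp
    qed
    then have I: "?I \<inter> {j, Suc j mod ?n} = {if even j then j else Suc j mod ?n}"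
      using j mlt by auto
    have "?I \<subseteq> {..<?n}" by auto
    from star[OF this j(1)] have "{p \<in> ?e ` ?I. v \<in> p} = ?e ` {if even j then j else Suc j mod ?n}"
      unfolding I j(2) .
    then show "vdeg (?e ` ?I) v = 1" unfolding vdeg_def by simp
  qed
  show "(u, v) \<in> {(a, b). {a, b} \<in> C}\<^sup>*" if uv: "u \<in> V" "v \<in> V"
  proof -
    let ?R = "{(a, b). {a, b} \<in> C}"
    have *: "(vs ! 0, vs ! i) \<in> ?R\<^sup>*" if "i < ?n" for i
      using that
    proof (induction i)
      case (Suc i)
      then have "{vs ! i, vs ! Suc i} = ?e i" by simp
      then have "(vs ! i, vs ! Suc i) \<in> ?R" using Suc vs by (auto simp: cycle_edges_def)
      then show ?case using Suc by (meson Suc_lessD rtrancl.rtrancl_into_rtrancl)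
    qed simp
    have "sym (?R\<^sup>*)" by (intro sym_rtrancl) (auto simp: sym_def insert_commute)
    moreover have "(vs ! 0, u) \<in> ?R\<^sup>*" "(vs ! 0, v) \<in> ?R\<^sup>*"
      using * uv vs by (metis in_set_conv_nth)+
    ultimately show ?thesis by (meson symD rtrancl_trans)
  qed
qed

subsection \<open>Trails and Eulerian graphs\<close>

text \<open>Walks are lists of arcs and \<open>ed\<close> forgets the direction: the same list then
  serves as an undirected trail and as an orientation of its edges.\<close>

fun ed :: "'v \<times> 'v \<Rightarrow> 'v set" where
  "ed (a, b) = {a, b}"

fun chain :: "'v \<Rightarrow> ('v \<times> 'v) list \<Rightarrow> 'v \<Rightarrow> bool" where
  "chain u [] v \<longleftrightarrow> u = v"
| "chain u (e # es) v \<longleftrightarrow> fst e = u \<and> chain (snd e) es v"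

lemma pair_in_ed_image: "{a, b} \<in> ed ` D \<longleftrightarrow> (a, b) \<in> D \<or> (b, a) \<in> D"
proof
  assume "{a, b} \<in> ed ` D"
  then obtain e where e: "e \<in> D" "{a, b} = ed e" by blast
  obtain x y where "e = (x, y)" by fastforce
  with e show "(a, b) \<in> D \<or> (b, a) \<in> D" by (auto simp: doubleton_eq_iff)
next
  assume "(a, b) \<in> D \<or> (b, a) \<in> D"
  then have "ed (a, b) \<in> ed ` D \<or> ed (b, a) \<in> ed ` D" by blast
  then show "{a, b} \<in> ed ` D" by (simp add: insert_commute)
qed

definition trail :: "'v set set \<Rightarrow> 'v \<Rightarrow> ('v \<times> 'v) list \<Rightarrow> 'v \<Rightarrow> bool" where
  "trail E u es v \<longleftrightarrow> chain u es v \<and> distinct (map ed es) \<and> ed ` set es \<subseteq> E"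

lemma chain_append: "chain u (p @ q) v \<longleftrightarrow> (\<exists>w. chain u p w \<and> chain w q v)"
  by (induction p arbitrary: u) auto

text \<open>A walk that traverses an edge, in either direction, visits both its ends; at such a
  visit another closed trail can be spliced in.\<close>

lemma chain_split:
  assumes "chain u es v" "{a, b} \<in> ed ` set es"
  shows "\<exists>p q. es = p @ q \<and> chain u p a \<and> chain a q v"
  using assms
proof (induction es arbitrary: u)
  case (Cons e es)
  obtain x y where e: "e = (x, y)" by (cases e)
  have x: "x = u" using Cons.prems e by simp
  show ?case
  proof (cases "a = u")
    case True
    then show ?thesis using Cons.prems by (intro exI[of _ "[]"] exI[of _ "e # es"]) auto
  next
    case False
    show ?thesis
    proof (cases "{a, b} \<in> ed ` set es")
      case True
      then obtain p q where "es = p @ q" "chain y p a" "chain a q v"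
        using Cons.IH[of y] Cons.prems e by auto
      then show ?thesis using e x by (intro exI[of _ "e # p"] exI[of _ q]) auto
    next
      case F: False
      then have "{a, b} = {x, y}" using Cons.prems e by auto
      then have "a = y" using False x by (auto simp: doubleton_eq_iff)
      then show ?thesis using e x Cons.prems by (intro exI[of _ "[e]"] exI[of _ es]) auto
    qed
  qed
qed simp

lemma vdeg_insert:
  assumes "finite P" "p \<notin> P"
  shows "vdeg (insert p P) w = of_bool (w \<in> p) + vdeg P w"
proof (cases "w \<in> p")
  case True
  then have "{q \<in> insert p P. w \<in> q} = insert p {q \<in> P. w \<in> q}" by auto
  then show ?thesis using assms True by (simp add: vdeg_def)
next
  case False
  then have "{q \<in> insert p P. w \<in> q} = {q \<in> P. w \<in> q}" by auto
  then show ?thesis using False by (simp add: vdeg_def)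
qed

lemma vdeg_empty [simp]: "vdeg {} v = 0"
  by (simp add: vdeg_def)

text \<open>Every inner visit to \<open>w\<close> uses two edges, so parity is disturbed only at the
  two ends of the walk, and not at all if they coincide.\<close>

lemma even_vdeg_chain:
  assumes "chain u es v" "distinct (map ed es)" "\<And>e. e \<in> set es \<Longrightarrow> fst e \<noteq> snd e"
  shows "even (vdeg (ed ` set es) w + of_bool (u = w) + of_bool (v = w))"
  using assms
proof (induction es arbitrary: u)
  case (Cons e es)
  obtain y where e: "e = (u, y)" using Cons.prems by (cases e) auto
  have "u \<noteq> y" using Cons.prems(3)[of e] e by auto
  have IH: "even (vdeg (ed ` set es) w + of_bool (y = w) + of_bool (v = w))"
    using Cons.IH[of y] Cons.prems e by auto
  have "vdeg (ed ` set (e # es)) w = of_bool (w \<in> {u, y}) + vdeg (ed ` set es) w"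
    using vdeg_insert[of "ed ` set es" "{u, y}" w] Cons.prems e by auto
  with IH \<open>u \<noteq> y\<close> show ?case by (auto simp: of_bool_def split: if_splits)
qed auto

lemma trail_even:
  assumes "trail E u es v" "E \<subseteq> pairs V"
  shows "even (vdeg (ed ` set es) w + of_bool (u = w) + of_bool (v = w))"
proof (rule even_vdeg_chain)
  fix e assume "e \<in> set es"
  then have "ed e \<in> pairs V" using assms by (auto simp: trail_def)
  then show "fst e \<noteq> snd e" by (cases e) auto
qed (use assms in \<open>auto simp: trail_def\<close>)

lemma trail_length:
  assumes "trail E u es v" "finite E"
  shows "length es \<le> card E"
proof -
  have "length es = card (ed ` set es)"
    using assms distinct_card[of "map ed es"] by (simp add: trail_def)
  also have "\<dots> \<le> card E" using assms by (intro card_mono) (auto simp: trail_def)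
  finally show ?thesis .
qed

lemma longest_trail:
  assumes "finite E" "Q es0" "\<And>es. Q es \<Longrightarrow> \<exists>v. trail E u es v"
  shows "\<exists>es. Q es \<and> (\<forall>es'. Q es' \<longrightarrow> length es' \<le> length es)"
proof -
  have "\<forall>es. Q es \<longrightarrow> length es < Suc (card E)"
    using assms(3) trail_length[OF _ assms(1)] by (meson le_imp_less_Suc)
  then show ?thesis using ex_has_greatest_nat[of Q es0 length "Suc (card E)"] assms(2) by blast
qed

lemma closed_trail:
  assumes fin: "finite V" and E: "E \<subseteq> pairs V" and even: "\<And>w. even (vdeg E w)"
    and p: "p \<in> E" "u \<in> p"
  shows "\<exists>es. es \<noteq> [] \<and> trail E u es u"
proof -
  have fE: "finite E" using finite_pairs_subset[OF fin E] .
  obtain x where x: "p = {u, x}"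
  proof -
    have "p \<in> pairs V" using p E by blast
    then obtain a b where "p = {a, b}" by (rule pairsE)
    then show ?thesis using p that by (cases "u = a") (auto simp: insert_commute)
  qed
  have t0: "trail E u [(u, x)] x" using p x by (auto simp: trail_def)
  obtain es where es: "\<exists>v. trail E u es v"
    and max: "\<And>es'. \<exists>v. trail E u es' v \<Longrightarrow> length es' \<le> length es"
    using longest_trail[OF fE, of "\<lambda>es. \<exists>v. trail E u es v" "[(u, x)]" u] t0 by blast
  from es obtain v where v: "trail E u es v" by blast
  have ne: "es \<noteq> []" using max[OF exI, OF t0] by auto
  have "v = u"
  proof (rule ccontr)
    assume vu: "v \<noteq> u"
    have sub: "ed ` set es \<subseteq> E" using v by (auto simp: trail_def)
    have "odd (vdeg (ed ` set es) v)" using trail_even[OF v E, of v] vu by auto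
    then have "vdeg (ed ` set es) v \<noteq> vdeg E v" using even by metis
    then have "{q \<in> ed ` set es. v \<in> q} \<noteq> {q \<in> E. v \<in> q}" by (auto simp: vdeg_def)
    then obtain q where q: "q \<in> E" "v \<in> q" "q \<notin> ed ` set es" using sub by blast
    then have "q \<in> pairs V" using E by blast
    then obtain a b where "q = {a, b}" by (rule pairsE)
    then obtain y where y: "q = {v, y}" using q by (cases "v = a") (auto simp: insert_commute)
    have "trail E u (es @ [(v, y)]) y"
      using v q y by (auto simp: trail_def chain_append)
    then show False using max[of "es @ [(v, y)]"] by auto
  qed
  with v ne show ?thesis by blast
qed

lemma even_vdeg_diff:
  assumes "finite E" "F \<subseteq> E" "even (vdeg E w)" "even (vdeg F w)"
  shows "even (vdeg (E - F) w)"
  using vdeg_diff[OF assms(1,2), of w] assms(3,4) by simp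

text \<open>A longest closed trail leaves a graph \<open>R\<close> with even degrees. If
  \<open>R\<close> has an edge, connectivity yields a vertex of the trail that meets
  \<open>R\<close>, and a closed trail of \<open>R\<close> can be inserted there.\<close>

theorem euler_circuit:
  assumes fin: "finite V" and E: "E \<subseteq> pairs V" and even: "\<And>w. even (vdeg E w)"
    and conn: "\<And>u v. u \<in> V \<Longrightarrow> v \<in> V \<Longrightarrow> (u, v) \<in> {(a, b). {a, b} \<in> E}\<^sup>*"
    and u: "u \<in> V"
  shows "\<exists>es. trail E u es u \<and> ed ` set es = E"
proof -
  have fE: "finite E" using finite_pairs_subset[OF fin E] .
  have "trail E u [] u" by (simp add: trail_def)
  then obtain es where es: "trail E u es u"
    and max: "\<And>es'. trail E u es' u \<Longrightarrow> length es' \<le> length es"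
    using longest_trail[OF fE, of "\<lambda>es. trail E u es u" "[]" u] by blast
  define R where "R = E - ed ` set es"
  have sub: "ed ` set es \<subseteq> E" using es by (auto simp: trail_def)
  have "R = {}"
  proof (rule ccontr)
    assume "R \<noteq> {}"
    then obtain p where p: "p \<in> R" by blast
    have RE: "R \<subseteq> pairs V" using E by (auto simp: R_def)
    define W where "W = {w. \<exists>q\<in>R. w \<in> q}"
    have Rev: "even (vdeg R w)" for w
      unfolding R_def using trail_even[OF es E, of w] even sub fE
      by (intro even_vdeg_diff) auto
    have "p \<in> pairs V" using p RE by blast
    then obtain a b where ab: "p = {a, b}" "a \<in> V" by (rule pairsE)
    then have aW: "a \<in> W" using p by (auto simp: W_def)
    have "\<exists>y\<in>W. \<exists>xs ys. es = xs @ ys \<and> chain u xs y \<and> chain y ys u"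
    proof (cases "u \<in> W")
      case True
      then show ?thesis using es by (intro bexI[of _ u] exI[of _ "[]"] exI[of _ es]) (auto simp: trail_def)
    next
      case False
      \<comment> \<open>A walk from \<open>a\<close> to \<open>u\<close> has to leave
        \<open>W\<close>. The edge where it does so has an end outside \<open>W\<close>, so it is
        not in \<open>R\<close> and belongs to the trail.\<close>
      have "\<exists>y\<in>W. \<exists>z. z \<notin> W \<and> {y, z} \<in> E"
      proof (rule ccontr)
        assume no: "\<not> ?thesis"
        have "(a, z) \<in> {(a, b). {a, b} \<in> E}\<^sup>* \<Longrightarrow> z \<in> W" for z
          by (induction rule: rtrancl_induct) (use aW no in auto)
        then show False using conn[OF ab(2) u] False by blast
      qed
      then obtain y z where yz: "y \<in> W" "z \<notin> W" "{y, z} \<in> E" by blast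
      then have "{y, z} \<notin> R" by (auto simp: W_def)
      then have "{y, z} \<in> ed ` set es" using yz by (auto simp: R_def)
      then show ?thesis using chain_split[of u es u y z] es yz by (auto simp: trail_def)
    qed
    then obtain y xs ys where y: "y \<in> W" "es = xs @ ys" "chain u xs y" "chain y ys u" by blast
    then obtain q where q: "q \<in> R" "y \<in> q" by (auto simp: W_def)
    obtain cs where cs: "cs \<noteq> []" "trail R y cs y"
      using closed_trail[OF fin RE Rev q] by blast
    have "trail E u (xs @ cs @ ys) u"
      using es cs y(2-4) sub by (auto simp: trail_def chain_append R_def)
    then show False using max[of "xs @ cs @ ys"] cs(1) y(2) by simp
  qed
  then show ?thesis using es sub by (auto simp: R_def)
qed

section \<open>Halving an Euler circuit\<close>

fun alt :: "'a list \<Rightarrow> 'a list" where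
  "alt [] = []"
| "alt [x] = [x]"
| "alt (x # y # zs) = x # alt zs"

lemma set_alt_subset: "set (alt xs) \<subseteq> set xs"
  by (induction xs rule: alt.induct) auto

text \<open>Of two consecutive edges exactly one is selected, so inner visits are balanced. The
  correction terms record that the first edge is selected and the last one is not; on a closed walk
  they cancel. The induction removes two edges at a time, hence the form for open walks.\<close>

lemma vdeg_alt:
  assumes "chain u es v" "distinct (map ed es)" "even (length es)" 
    "\<And>e. e \<in> set es \<Longrightarrow> fst e \<noteq> snd e"
  shows "2 * int (vdeg (ed ` set (alt es)) w)
    = int (vdeg (ed ` set es) w) + of_bool (u = w) - of_bool (v = w)"
  using assms
proof (induction es arbitrary: u rule: alt.induct)
  case (3 e f es)
  obtain y where e: "e = (u, y)" using 3 by (cases e) auto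
  obtain z where f: "f = (y, z)" using 3 e by (cases f) auto
  have ne: "u \<noteq> y" "y \<noteq> z" using 3(5)[of e] 3(5)[of f] e f by auto
  have IH: "2 * int (vdeg (ed ` set (alt es)) w)
    = int (vdeg (ed ` set es) w) + of_bool (z = w) - of_bool (v = w)"
    using 3 f by auto
  have "{y, z} \<notin> ed ` set es" "{u, y} \<notin> insert {y, z} (ed ` set es)"
    using 3(3) e f by auto
  moreover have "{u, y} \<notin> ed ` set (alt es)"
    using calculation(2) set_alt_subset[of es] by blast
  ultimately have "vdeg (ed ` set (alt (e # f # es))) w = of_bool (w \<in> {u, y}) + vdeg (ed ` set (alt es)) w"
    "vdeg (ed ` set (e # f # es)) w = of_bool (w \<in> {u, y}) + (of_bool (w \<in> {y, z}) + vdeg (ed ` set es) w)"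
    using e f by (simp_all add: vdeg_insert)
  then show ?case using IH ne by (auto simp: of_bool_def split: if_splits)
qed auto

theorem balanced_halving:
  assumes fin: "finite V" and E: "E \<subseteq> pairs V" and even: "\<And>w. even (vdeg E w)"
    and conn: "\<And>u v. u \<in> V \<Longrightarrow> v \<in> V \<Longrightarrow> (u, v) \<in> {(a, b). {a, b} \<in> E}\<^sup>*"
    and card: "even (card E)" and V: "V \<noteq> {}"
  shows "\<exists>A\<subseteq>E. \<forall>w. 2 * vdeg A w = vdeg E w"
proof -
  obtain u where u: "u \<in> V" using V by blast
  obtain es where es: "trail E u es u" "ed ` set es = E"
    using euler_circuit[OF fin E even conn u] by blast
  have "length es = card E"
    using es distinct_card[of "map ed es"] by (simp add: trail_def)
  moreover have "fst e \<noteq> snd e" if "e \<in> set es" for e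
  proof -
    have "ed e \<in> pairs V" using es E that by auto
    then show ?thesis by (cases e) auto
  qed
  ultimately have int: "2 * int (vdeg (ed ` set (alt es)) w) = int (vdeg E w)" for w
    using vdeg_alt[of u es u w] es card by (auto simp: trail_def)
  have "2 * vdeg (ed ` set (alt es)) w = vdeg E w" for w
    using int[of w] by linarith
  moreover have "ed ` set (alt es) \<subseteq> E" using es set_alt_subset[of es] by blast
  ultimately show ?thesis by blast
qed

section \<open>Balanced orientations\<close>

lemma chain_balance:
  assumes "chain u es v" "distinct es"
  shows "int (card {e \<in> set es. fst e = w}) + of_bool (v = w) =
    int (card {e \<in> set es. snd e = w}) + of_bool (u = w)"
  using assms
proof (induction es arbitrary: u)
  case (Cons e es)
  obtain y where e: "e = (u, y)" using Cons.prems by (cases e) auto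
  have IH: "int (card {e \<in> set es. fst e = w}) + of_bool (v = w) =
    int (card {e \<in> set es. snd e = w}) + of_bool (y = w)"
    using Cons e by auto
  have ins: "card {d \<in> set (e # es). P d} = of_bool (P e) + card {d \<in> set es. P d}" for P
  proof (cases "P e")
    case True
    then have "{d \<in> set (e # es). P d} = insert e {d \<in> set es. P d}" by auto
    then show ?thesis using Cons.prems True by simp
  next
    case False
    then have "{d \<in> set (e # es). P d} = {d \<in> set es. P d}" by auto
    then show ?thesis using False by simp
  qed
  show ?case unfolding ins using IH e by auto
qed auto

text \<open>Closed trails are removed one at a time and each is oriented along its traversal, so the
  components of the graph need no separate treatment.\<close>

theorem balanced_orientation:
  assumes fin: "finite V" and E: "E \<subseteq> pairs V" and even: "\<And>w. even (vdeg E w)"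
  shows "\<exists>A. (\<forall>a b. {a, b} \<in> E \<longleftrightarrow> (a, b) \<in> A \<or> (b, a) \<in> A) \<and> (\<forall>a b. (a, b) \<in> A \<longrightarrow> (b, a) \<notin> A)
    \<and> (\<forall>w. card {e \<in> A. fst e = w} = card {e \<in> A. snd e = w})"
  using E even
proof (induction "card E" arbitrary: E rule: less_induct)
  case less
  have fE: "finite E" using finite_pairs_subset[OF fin less(2)] .
  show ?case
  proof (cases "E = {}")
    case True
    then show ?thesis by (intro exI[of _ "{}"]) auto
  next
    case False
    then obtain p where p: "p \<in> E" by blast
    then have "p \<in> pairs V" using less(2) by blast
    then obtain u x where "p = {u, x}" by (rule pairsE)
    then obtain es where es: "es \<noteq> []" "trail E u es u"
      using closed_trail[OF fin less(2,3) p, of u] by auto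
    define F where "F = E - ed ` set es"
    have sub: "ed ` set es \<subseteq> E" using es by (auto simp: trail_def)
    have "even (vdeg F w)" for w
      unfolding F_def using trail_even[OF es(2) less(2), of w] less(3) sub fE
      by (intro even_vdeg_diff) auto
    moreover have "card F < card E"
    proof (intro psubset_card_mono fE psubsetI)
      obtain e where "e \<in> set es" using es(1) by (cases es) auto
      then have "ed e \<in> E" "ed e \<notin> F" using sub by (auto simp: F_def)
      then show "F \<noteq> E" by blast
    qed (auto simp: F_def)
    moreover have "F \<subseteq> pairs V" using less(2) by (auto simp: F_def)
    ultimately obtain A where A: "\<forall>a b. {a, b} \<in> F \<longleftrightarrow> (a, b) \<in> A \<or> (b, a) \<in> A"
      "\<forall>a b. (a, b) \<in> A \<longrightarrow> (b, a) \<notin> A" "\<forall>w. card {e \<in> A. fst e = w} = card {e \<in> A. snd e = w}"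
      using less(1)[of F] by blast
    have AV: "A \<subseteq> V \<times> V"
    proof clarify
      fix a b assume "(a, b) \<in> A"
      then have "{a, b} \<in> pairs V" using A \<open>F \<subseteq> pairs V\<close> by blast
      then show "a \<in> V \<and> b \<in> V" by simp
    qed
    have fA: "finite A" using finite_subset[OF AV] fin by simp
    have dis: "(a, b) \<notin> A \<and> (b, a) \<notin> A" if ab: "(a, b) \<in> set es" for a b
    proof -
      have "{a, b} \<in> ed ` set es" using imageI[OF ab, of ed] by simp
      then have "{a, b} \<notin> F" by (simp add: F_def)
      then show ?thesis using A(1) by blast
    qed
    have dm: "distinct (map ed es)" using es by (simp add: trail_def)
    have one: "(b, a) \<notin> set es" if "(a, b) \<in> set es" for a b
    proof
      assume "(b, a) \<in> set es"
      moreover have "inj_on ed (set es)" using dm by (simp add: distinct_map)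
      moreover have "ed (a, b) = ed (b, a)" by (simp add: insert_commute)
      ultimately have "a = b" using that by (metis inj_onD prod.inject)
      moreover have "ed (a, b) \<in> pairs V" using that less(2) sub by blast
      ultimately show False by simp
    qed
    have "card {e \<in> A \<union> set es. fst e = w} = card {e \<in> A \<union> set es. snd e = w}" for w
    proof -
      have un: "card {e \<in> A \<union> set es. P e} = card {e \<in> A. P e} + card {e \<in> set es. P e}" for P
      proof -
        have "{e \<in> A \<union> set es. P e} = {e \<in> A. P e} \<union> {e \<in> set es. P e}" by blast
        moreover have "card \<dots> = card {e \<in> A. P e} + card {e \<in> set es. P e}"
          using fA dis by (intro card_Un_disjoint) fastforce+
        ultimately show ?thesis by simp
      qed
      have "card {e \<in> set es. fst e = w} = card {e \<in> set es. snd e = w}"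
        using chain_balance[of u es u w] es dm by (simp add: trail_def distinct_map)
      then show ?thesis unfolding un using A by simp
    qed
    moreover have "{a, b} \<in> E \<longleftrightarrow> (a, b) \<in> A \<union> set es \<or> (b, a) \<in> A \<union> set es" for a b
    proof -
      have "{a, b} \<in> ed ` set es \<longleftrightarrow> (a, b) \<in> set es \<or> (b, a) \<in> set es"
        by (rule pair_in_ed_image)
      moreover have "{a, b} \<in> E \<longleftrightarrow> {a, b} \<in> F \<or> {a, b} \<in> ed ` set es"
        using sub by (auto simp: F_def)
      ultimately show ?thesis using A by blast
    qed
    moreover have "(b, a) \<notin> A \<union> set es" if "(a, b) \<in> A \<union> set es" for a b
      using that A dis one by blast
    ultimately show ?thesis by (intro exI[of _ "A \<union> set es"]) blast
  qed
qed

subsection \<open>Bipartite rounding\<close>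

lemma sum_of_bool_le_1:
  assumes "finite I" "\<And>k l. k \<in> I \<Longrightarrow> l \<in> I \<Longrightarrow> P k \<Longrightarrow> P l \<Longrightarrow> k = l"
  shows "(\<Sum>k\<in>I. of_bool (P k) :: int) \<le> 1"
proof -
  have "(\<Sum>k\<in>I. of_bool (P k) :: int) = int (card {k \<in> I. P k})"
    using assms(1) by (simp add: of_bool_def sum.If_cases Int_def)
  moreover have "card {k \<in> I. P k} \<le> 1"
    by (rule card_le_Suc0_iff_eq[THEN iffD2, simplified One_nat_def[symmetric]]) (use assms in auto)
  ultimately show ?thesis by linarith
qed

text \<open>A walk alternating between rows and columns is cut at the first row it visits twice;
  the signs along this closed walk give the perturbation.\<close>

lemma alternating_cycle:
  fixes F :: "('a \<times> 'b) set"
  assumes fin: "finite R" "finite C" and F: "F \<subseteq> R \<times> C" "F \<noteq> {}"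
    and row: "\<And>i j. (i, j) \<in> F \<Longrightarrow> \<exists>j'. j' \<noteq> j \<and> (i, j') \<in> F"
    and col: "\<And>i j. (i, j) \<in> F \<Longrightarrow> \<exists>i'. i' \<noteq> i \<and> (i', j) \<in> F"
  obtains \<epsilon> :: "'a \<Rightarrow> 'b \<Rightarrow> int" where
    "\<And>x y. \<epsilon> x y \<noteq> 0 \<Longrightarrow> (x, y) \<in> F" "\<And>x y. \<bar>\<epsilon> x y\<bar> \<le> 1" "\<exists>x y. \<epsilon> x y \<noteq> 0"
    "\<And>x. (\<Sum>y\<in>C. \<epsilon> x y) = 0" "\<And>y. (\<Sum>x\<in>R. \<epsilon> x y) = 0"
proof -
  obtain e0 where e0: "e0 \<in> F" using F by blast
  \<comment> \<open>One step goes along row \<open>i\<close> to a new column \<open>j\<close> and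
    then along that column to a new row. The stored column is the one just used, which must be
    avoided next.\<close>
  define step where "step = (\<lambda>(i, c). let j = (SOME j. j \<noteq> c \<and> (i, j) \<in> F) in
    (SOME i'. i' \<noteq> i \<and> (i', j) \<in> F, j))"
  define s where "s k = (step ^^ k) e0" for k
  have step: "snd (step (i, c)) \<noteq> c \<and> (i, snd (step (i, c))) \<in> F \<and>
      fst (step (i, c)) \<noteq> i \<and> step (i, c) \<in> F" if "(i, c) \<in> F" for i c
  proof -
    define j where "j = (SOME j. j \<noteq> c \<and> (i, j) \<in> F)"
    have j: "j \<noteq> c \<and> (i, j) \<in> F"
      unfolding j_def by (rule someI_ex) (rule row[OF that])
    define i' where "i' = (SOME i'. i' \<noteq> i \<and> (i', j) \<in> F)"
    have i': "i' \<noteq> i \<and> (i', j) \<in> F"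
      unfolding i'_def by (rule someI_ex) (rule col, use j in blast)
    have "step (i, c) = (i', j)" by (simp add: step_def j_def i'_def Let_def)
    then show ?thesis using j i' by simp
  qed
  have sF: "s k \<in> F" for k
  proof (induction k)
    case (Suc k)
    then show ?case using step[of "fst (s k)" "snd (s k)"] by (simp add: s_def)
  qed (simp add: s_def e0)
  define i where "i k = fst (s k)" for k
  define j where "j k = snd (s (Suc k))" for k
  have ij: "(i k, j k) \<in> F" "(i (Suc k), j k) \<in> F" "i (Suc k) \<noteq> i k" "j (Suc k) \<noteq> j k" for k
    using step[of "fst (s k)" "snd (s k)"] step[of "fst (s (Suc k))" "snd (s (Suc k))"] sF[of k] sF[of "Suc k"]
    by (simp_all add: i_def j_def s_def)
  have "i ` UNIV \<subseteq> R" using ij(1) F(1) by auto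
  then have "\<not> inj i" using fin(1) finite_imageD[of i UNIV] finite_subset by auto
  then obtain k l where "i k = i l" "k \<noteq> l" by (auto simp: inj_def)
  then have "\<exists>b. \<exists>a<b. i a = i b" by (metis linorder_neqE_nat)
  \<comment> \<open>For the first repetition \<open>b\<close>, the rows \<open>i a\<close>, ...,
    \<open>i (b - 1)\<close> are distinct; columns may well repeat.\<close>
  then obtain b where b: "\<exists>a<b. i a = i b" and least: "\<And>b'. b' < b \<Longrightarrow> \<not> (\<exists>a<b'. i a = i b')"
    using exists_least_iff[of "\<lambda>b. \<exists>a<b. i a = i b"] by auto
  then obtain a where a: "a < b" "i a = i b" by blast
  have inj: "k = l" if "k < b" "l < b" "i k = i l" for k l
    using least[of k] least[of l] that by (metis linorder_neqE_nat)
  have inj': "k = l" if "k \<in> {a..<b}" "l \<in> {a..<b}" "i (Suc k) = i (Suc l)" for k l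
  proof (cases "Suc k = b \<or> Suc l = b")
    case True
    then show ?thesis
    proof
      assume k: "Suc k = b"
      then have "i (Suc l) = i a" using that a by simp
      then show "k = l" using inj[of "Suc l" a] that a k by (cases "Suc l < b") auto
    next
      assume l: "Suc l = b"
      then have "i (Suc k) = i a" using that a by simp
      then show "k = l" using inj[of "Suc k" a] that a l by (cases "Suc k < b") auto
    qed
  next
    case False
    then show ?thesis using inj[of "Suc k" "Suc l"] that by auto
  qed
  have ab: "Suc a < b" using ij(3)[of a] a by (metis Suc_lessI)
  \<comment> \<open>\<open>P\<close> marks the cells where the walk leaves a row, \<open>Q\<close>
    those where it enters the next one; \<open>P - Q\<close> is the perturbation. Distinctness of
    the rows keeps both indicators at most 1.\<close>
  define P where "P x y = (\<Sum>k\<in>{a..<b}. of_bool (x = i k \<and> y = j k) :: int)" for x y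
  define Q where "Q x y = (\<Sum>k\<in>{a..<b}. of_bool (x = i (Suc k) \<and> y = j k) :: int)" for x y
  have PQ: "0 \<le> P x y" "P x y \<le> 1" "0 \<le> Q x y" "Q x y \<le> 1" for x y
  proof -
    show "0 \<le> P x y" "0 \<le> Q x y" unfolding P_def Q_def by (intro sum_nonneg; simp)+
    show "P x y \<le> 1" unfolding P_def by (intro sum_of_bool_le_1) (use inj in auto)
    show "Q x y \<le> 1" unfolding Q_def by (intro sum_of_bool_le_1) (use inj' in auto)
  qed
  have supp: "(x, y) \<in> F" if "P x y - Q x y \<noteq> 0" for x y
  proof (rule ccontr)
    assume "(x, y) \<notin> F"
    then have "P x y = 0" "Q x y = 0" unfolding P_def Q_def
      using ij(1,2) by (auto intro!: sum.neutral)
    then show False using that by simp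
  qed
  show ?thesis
  proof
    show "\<bar>P x y - Q x y\<bar> \<le> 1" for x y using PQ[of x y] by linarith
    show "\<exists>x y. P x y - Q x y \<noteq> 0"
    proof (intro exI)
      \<comment> \<open>A cell at which \<open>P\<close> and \<open>Q\<close> do not cancel: row
        \<open>i (Suc a)\<close> is entered only at step \<open>a\<close>, and in the column
        \<open>j a\<close>, which differs from \<open>j (Suc a)\<close>.\<close>
      have "Q (i (Suc a)) (j (Suc a)) = 0"
        unfolding Q_def
      proof (intro sum.neutral ballI)
        fix k assume k: "k \<in> {a..<b}"
        have "k = a" if "i (Suc a) = i (Suc k)"
          using inj'[of a k] k that a by auto
        then show "of_bool (i (Suc a) = i (Suc k) \<and> j (Suc a) = j k) = (0::int)"
          using ij(4)[of a] by auto
      qed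
      moreover have "1 \<le> P (i (Suc a)) (j (Suc a))"
        unfolding P_def using ab
        by (subst sum.remove[of _ "Suc a"]) (auto intro!: sum_nonneg)
      ultimately show "P (i (Suc a)) (j (Suc a)) - Q (i (Suc a)) (j (Suc a)) \<noteq> 0" by simp
    qed
    have ind: "(\<Sum>y\<in>C. of_bool (p \<and> y = j k) :: int) = of_bool p" for p k
      using ij(1)[of k] F(1) fin by (cases p) (auto simp: of_bool_def sum.If_cases)
    have ind': "(\<Sum>x\<in>R. of_bool (x = i k \<and> p) :: int) = of_bool p" for p k
      using ij(1)[of k] F(1) fin by (cases p) (auto simp: of_bool_def sum.If_cases)
    \<comment> \<open>Row sums telescope to zero because \<open>i a = i b\<close>; in a column,
      \<open>P\<close> and \<open>Q\<close> cancel step by step.\<close>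
    show "(\<Sum>y\<in>C. P x y - Q x y) = 0" for x
    proof -
      have "(\<Sum>y\<in>C. P x y) = (\<Sum>k\<in>{a..<b}. of_bool (x = i k))"
        unfolding P_def by (subst sum.swap) (simp add: ind)
      moreover have "(\<Sum>y\<in>C. Q x y) = (\<Sum>k\<in>{a..<b}. of_bool (x = i (Suc k)))"
        unfolding Q_def by (subst sum.swap) (simp add: ind)
      moreover have "(\<Sum>k\<in>{a..<b}. of_bool (x = i (Suc k)) - of_bool (x = i k) :: int) =
          of_bool (x = i b) - of_bool (x = i a)"
        using a by (intro sum_Suc_diff') auto
      ultimately show ?thesis using a by (simp add: sum_subtractf)
    qed
    show "(\<Sum>x\<in>R. P x y - Q x y) = 0" for y
    proof -
      have "(\<Sum>x\<in>R. P x y) = (\<Sum>k\<in>{a..<b}. of_bool (y = j k))"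
        unfolding P_def by (subst sum.swap) (simp add: ind')
      moreover have "(\<Sum>x\<in>R. Q x y) = (\<Sum>k\<in>{a..<b}. of_bool (y = j k))"
        unfolding Q_def by (subst sum.swap) (simp add: ind')
      ultimately show ?thesis by (simp add: sum_subtractf)
    qed
  qed (use supp in auto)
qed

text \<open>Rounds \<open>M / t\<close> to a 0/1 matrix with the same line sums: a minimiser of a
  strictly concave objective over the integer matrices with entries from 0 to \<open>t\<close> and
  the line sums of \<open>M\<close> has only the entries 0 and \<open>t\<close>, since an
  alternating cycle of other entries could be perturbed either way. Entries 0 and \<open>t\<close>
  of \<open>M\<close> are kept. \<open>K\<close> is a set of cells whose total weight must not
  grow.\<close>

theorem bipartite_rounding:
  fixes M :: "'a \<Rightarrow> 'b \<Rightarrow> nat"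
  assumes fin: "finite R" "finite C" and t: "0 < t"
    and le: "\<And>i j. i \<in> R \<Longrightarrow> j \<in> C \<Longrightarrow> M i j \<le> t"
    and row: "\<And>i. i \<in> R \<Longrightarrow> t dvd (\<Sum>j\<in>C. M i j)"
    and col: "\<And>j. j \<in> C \<Longrightarrow> t dvd (\<Sum>i\<in>R. M i j)"
    and K: "K \<subseteq> R \<times> C"
  obtains X where "X \<subseteq> R \<times> C"
    "\<And>i j. (i, j) \<in> X \<Longrightarrow> 0 < M i j"
    "\<And>i j. i \<in> R \<Longrightarrow> j \<in> C \<Longrightarrow> M i j = t \<Longrightarrow> (i, j) \<in> X"
    "\<And>i. i \<in> R \<Longrightarrow> t * card {j. (i, j) \<in> X} = (\<Sum>j\<in>C. M i j)"
    "\<And>j. j \<in> C \<Longrightarrow> t * card {i. (i, j) \<in> X} = (\<Sum>i\<in>R. M i j)"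
    "t * card (X \<inter> K) \<le> (\<Sum>(i, j)\<in>K. M i j)"
proof -
  define feas where "feas N \<longleftrightarrow>
      (\<forall>i\<in>R. \<forall>j\<in>C. 0 \<le> N i j \<and> N i j \<le> int t \<and> (M i j = 0 \<longrightarrow> N i j = 0) \<and>
        (M i j = t \<longrightarrow> N i j = int t)) \<and>
      (\<forall>i\<in>R. (\<Sum>j\<in>C. N i j) = int (\<Sum>j\<in>C. M i j)) \<and>
      (\<forall>j\<in>C. (\<Sum>i\<in>R. N i j) = int (\<Sum>i\<in>R. M i j))" for N :: "'a \<Rightarrow> 'b \<Rightarrow> int"
  define B where "B = int (card (R \<times> C)) * (int t)\<^sup>2"
  define cost where "cost N = (\<Sum>(i, j)\<in>K. N i j)" for N :: "'a \<Rightarrow> 'b \<Rightarrow> int"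
  define sq where "sq N = (\<Sum>(i, j)\<in>R \<times> C. (N i j)\<^sup>2)" for N :: "'a \<Rightarrow> 'b \<Rightarrow> int"
  \<comment> \<open>Strictly concave along every line, so a minimiser has no entry strictly between \<open>0\<close> and \<open>t\<close>;
    the factor \<open>B + 1\<close> makes the cost take precedence.\<close>
  define f where "f N = (B + 1) * cost N - sq N" for N :: "'a \<Rightarrow> 'b \<Rightarrow> int"
  have sqB: "0 \<le> sq N" "sq N \<le> B" if "feas N" for N
  proof -
    show "0 \<le> sq N" unfolding sq_def by (intro sum_nonneg) auto
    have "sq N \<le> (\<Sum>(i, j)\<in>R \<times> C. (int t)\<^sup>2)"
      unfolding sq_def using that by (intro sum_mono) (auto simp: feas_def intro!: power_mono)
    then show "sq N \<le> B" by (simp add: B_def split_def)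
  qed
  have cost0: "0 \<le> cost N" if "feas N" for N
    unfolding cost_def using that K by (intro sum_nonneg) (auto simp: feas_def)
  have B0: "0 \<le> B" by (simp add: B_def)
  have f0: "0 \<le> f N + B" if "feas N" for N
  proof -
    have "0 \<le> (B + 1) * cost N" using cost0[OF that] B0 by (intro mult_nonneg_nonneg) auto
    then show ?thesis using sqB[OF that] unfolding f_def by linarith
  qed
  let ?M = "\<lambda>i j. int (M i j)"
  have fM: "feas ?M" using le by (simp add: feas_def)
  obtain N where N: "feas N" and min: "\<And>N'. feas N' \<Longrightarrow> nat (f N + B) \<le> nat (f N' + B)"
    using ex_has_least_nat[of feas ?M "\<lambda>N. nat (f N + B)"] fM by blast
  have min: "f N \<le> f N'" if "feas N'" for N'
    using min[OF that] f0[OF that] f0[OF N] by linarith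
  define F where "F = {(i, j). i \<in> R \<and> j \<in> C \<and> N i j \<noteq> 0 \<and> N i j \<noteq> int t}"
  have "F = {}"
  proof (rule ccontr)
    assume ne: "F \<noteq> {}"
    \<comment> \<open>In a line whose sum is divisible by \<open>t\<close>, a single entry strictly
      between 0 and \<open>t\<close> cannot stand alone, as all others would be multiples of
      \<open>t\<close>.\<close>
    have other: "\<exists>y'\<in>Y. y' \<noteq> y \<and> g y' \<noteq> 0 \<and> g y' \<noteq> int t"
      if g: "finite Y" "y \<in> Y" "int t dvd (\<Sum>y\<in>Y. g y)" "0 \<le> g y" "g y \<le> int t" "g y \<noteq> 0" "g y \<noteq> int t"
      for Y :: "'c set" and y g
    proof (rule ccontr)
      assume "\<not> ?thesis"
      then have "int t dvd g y'" if "y' \<in> Y - {y}" for y' using that by auto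
      then have "int t dvd (\<Sum>y\<in>Y - {y}. g y)" by (rule dvd_sum)
      moreover have "(\<Sum>y\<in>Y. g y) = g y + (\<Sum>y\<in>Y - {y}. g y)" using g(1,2) by (rule sum.remove)
      ultimately have "int t dvd g y" using g(3) dvd_add_left_iff by metis
      then show False using g(4-) zdvd_imp_le[of "int t" "g y"] by linarith
    qed
    have FRC: "F \<subseteq> R \<times> C" by (auto simp: F_def)
    have r: "\<exists>j'. j' \<noteq> j \<and> (i, j') \<in> F" if "(i, j) \<in> F" for i j
    proof -
      have *: "i \<in> R" "j \<in> C" "N i j \<noteq> 0" "N i j \<noteq> int t" using that by (auto simp: F_def)
      have "int t dvd (\<Sum>j\<in>C. N i j)"
        using N * row[OF *(1)] by (simp only: feas_def) (metis int_dvd_int_iff)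
      moreover have "0 \<le> N i j" "N i j \<le> int t" using N * by (auto simp: feas_def)
      ultimately obtain j' where "j' \<in> C" "j' \<noteq> j" "N i j' \<noteq> 0" "N i j' \<noteq> int t"
        using other[of C j "N i"] * fin by blast
      then show ?thesis using * by (auto simp: F_def)
    qed
    have c: "\<exists>i'. i' \<noteq> i \<and> (i', j) \<in> F" if "(i, j) \<in> F" for i j
    proof -
      have *: "i \<in> R" "j \<in> C" "N i j \<noteq> 0" "N i j \<noteq> int t" using that by (auto simp: F_def)
      have "int t dvd (\<Sum>i\<in>R. N i j)"
        using N * col[OF *(2)] by (simp only: feas_def) (metis int_dvd_int_iff)
      moreover have "0 \<le> N i j" "N i j \<le> int t" using N * by (auto simp: feas_def)
      ultimately obtain i' where "i' \<in> R" "i' \<noteq> i" "N i' j \<noteq> 0" "N i' j \<noteq> int t"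
        using other[of R i "\<lambda>i. N i j"] * fin by blast
      then show ?thesis using * by (auto simp: F_def)
    qed
    obtain \<epsilon> :: "'a \<Rightarrow> 'b \<Rightarrow> int" where e: "\<And>x y. \<epsilon> x y \<noteq> 0 \<Longrightarrow> (x, y) \<in> F" "\<And>x y. \<bar>\<epsilon> x y\<bar> \<le> 1" "\<exists>x y. \<epsilon> x y \<noteq> 0"
      "\<And>x. (\<Sum>y\<in>C. \<epsilon> x y) = 0" "\<And>y. (\<Sum>x\<in>R. \<epsilon> x y) = 0"
      by (rule alternating_cycle[OF fin FRC ne]) (use r c in blast)+
    have feas: "feas (\<lambda>i j. N i j + c * \<epsilon> i j)" if c: "c = 1 \<or> c = -1" for c
      unfolding feas_def
    proof (intro conjI ballI)
      fix i j assume ij: "i \<in> R" "j \<in> C"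
      have N': "0 \<le> N i j" "N i j \<le> int t" "M i j = 0 \<longrightarrow> N i j = 0" "M i j = t \<longrightarrow> N i j = int t"
        using N ij by (auto simp: feas_def)
      have "\<epsilon> i j = 0 \<or> (N i j \<noteq> 0 \<and> N i j \<noteq> int t)" using e(1)[of i j] by (auto simp: F_def)
      then show "0 \<le> N i j + c * \<epsilon> i j" "N i j + c * \<epsilon> i j \<le> int t"
        "M i j = 0 \<longrightarrow> N i j + c * \<epsilon> i j = 0" "M i j = t \<longrightarrow> N i j + c * \<epsilon> i j = int t"
        using N' e(2)[of i j] c by auto
    next
      fix i assume "i \<in> R"
      then show "(\<Sum>j\<in>C. N i j + c * \<epsilon> i j) = int (\<Sum>j\<in>C. M i j)"
        using N e(4)[of i] by (simp add: sum.distrib feas_def flip: sum_distrib_left)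
    next
      fix j assume "j \<in> C"
      then show "(\<Sum>i\<in>R. N i j + c * \<epsilon> i j) = int (\<Sum>i\<in>R. M i j)"
        using N e(5)[of j] by (simp add: sum.distrib feas_def flip: sum_distrib_left)
    qed
    have cost: "cost (\<lambda>i j. N i j + c * \<epsilon> i j) = cost N + c * cost \<epsilon>" for c
      by (simp add: cost_def split_def sum.distrib sum_distrib_left)
    \<comment> \<open>The parallelogram identity. As the cost is linear, the two perturbed values of
      \<open>f\<close> add up to \<open>2 * f N - 2 * sq \<epsilon>\<close>, so one of them is below
      \<open>f N\<close>.\<close>
    have sq: "sq (\<lambda>i j. N i j + 1 * \<epsilon> i j) + sq (\<lambda>i j. N i j + (-1) * \<epsilon> i j) = 2 * sq N + 2 * sq \<epsilon>"
      unfolding sq_def sum_distrib_left sum.distrib[symmetric]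
      by (intro sum.cong) (auto simp: power2_eq_square algebra_simps)
    have "0 < sq \<epsilon>"
    proof -
      obtain x y where xy: "\<epsilon> x y \<noteq> 0" using e(3) by blast
      then have "(x, y) \<in> R \<times> C" using e(1) FRC by blast
      then show ?thesis unfolding sq_def using fin xy
        by (intro sum_pos2[of _ "(x, y)"]) auto
    qed
    moreover have "f N \<le> f (\<lambda>i j. N i j + 1 * \<epsilon> i j)" "f N \<le> f (\<lambda>i j. N i j + (-1) * \<epsilon> i j)"
      using min[OF feas[of 1]] min[OF feas[of "-1"]] by auto
    ultimately show False using sq unfolding f_def cost by (simp add: algebra_simps)
  qed
  then have N01: "N i j = 0 \<or> N i j = int t" if "i \<in> R" "j \<in> C" for i j
    using that by (auto simp: F_def)
  define X where "X = {(i, j). i \<in> R \<and> j \<in> C \<and> N i j = int t}"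
  have NX: "N i j = int t * of_bool ((i, j) \<in> X)" if "i \<in> R" "j \<in> C" for i j
    using N01[OF that] that t by (auto simp: X_def)
  have XRC: "X \<subseteq> R \<times> C" by (auto simp: X_def)
  show ?thesis
  proof
    show "X \<subseteq> R \<times> C" by fact
    show "0 < M i j" if "(i, j) \<in> X" for i j
    proof (rule ccontr)
      assume "\<not> 0 < M i j"
      then have "N i j = 0" using N that by (auto simp: feas_def X_def)
      then show False using that t by (simp add: X_def)
    qed
    show "(i, j) \<in> X" if "i \<in> R" "j \<in> C" "M i j = t" for i j
      using that N by (auto simp: feas_def X_def)
    show "t * card {j. (i, j) \<in> X} = (\<Sum>j\<in>C. M i j)" if "i \<in> R" for i
    proof -
      have eq: "C \<inter> {j. (i, j) \<in> X} = {j. (i, j) \<in> X}" using XRC by auto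
      have "int (\<Sum>j\<in>C. M i j) = (\<Sum>j\<in>C. N i j)" using N that by (simp add: feas_def)
      also have "\<dots> = (\<Sum>j\<in>C. int t * of_bool ((i, j) \<in> X))" using NX that by (intro sum.cong) auto
      also have "\<dots> = int t * int (card {j. (i, j) \<in> X})"
        using fin eq by (simp add: of_bool_def sum.If_cases flip: sum_distrib_left)
      finally show ?thesis by (metis of_nat_eq_iff of_nat_mult)
    qed
    show "t * card {i. (i, j) \<in> X} = (\<Sum>i\<in>R. M i j)" if "j \<in> C" for j
    proof -
      have eq: "R \<inter> {i. (i, j) \<in> X} = {i. (i, j) \<in> X}" using XRC by auto
      have "int (\<Sum>i\<in>R. M i j) = (\<Sum>i\<in>R. N i j)" using N that by (simp add: feas_def)
      also have "\<dots> = (\<Sum>i\<in>R. int t * of_bool ((i, j) \<in> X))" using NX that by (intro sum.cong) auto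
      also have "\<dots> = int t * int (card {i. (i, j) \<in> X})"
        using fin eq by (simp add: of_bool_def sum.If_cases flip: sum_distrib_left)
      finally show ?thesis by (metis of_nat_eq_iff of_nat_mult)
    qed
    have fK: "finite K" using K fin finite_subset by blast
    have "cost N = (\<Sum>e\<in>K. int t * of_bool (e \<in> X))"
      unfolding cost_def using NX K by (intro sum.cong) auto
    also have "\<dots> = int t * int (card (X \<inter> K))"
      using fK by (simp add: of_bool_def sum.If_cases Int_commute flip: sum_distrib_left)
    finally have cN: "cost N = int (t * card (X \<inter> K))" by simp
    \<comment> \<open>The square terms of two feasible matrices differ by at most \<open>B\<close>,
      so integrality of the cost excludes any increase.\<close>
    have "(B + 1) * cost N < (B + 1) * (cost ?M + 1)"
      using min[OF fM] sqB[OF N] sqB[OF fM] by (simp add: f_def algebra_simps)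
    then have "cost N \<le> cost ?M" using B0 by (simp add: mult_less_cancel_left_pos)
    also have "cost ?M = int (\<Sum>(i, j)\<in>K. M i j)" by (simp add: cost_def split_def)
    finally show "t * card (X \<inter> K) \<le> (\<Sum>(i, j)\<in>K. M i j)"
      unfolding cN of_nat_le_iff .
  qed
qed

subsection \<open>Splitting off a Hamilton cycle\<close>

text \<open>The set \<open>R\<close> of vertices reachable from \<open>v\<close> has no leaving
  arcs; by balance as many arcs start in \<open>R\<close> as end in it, so none enters
  \<open>R\<close> from outside. The arc from \<open>u\<close> ends in \<open>R\<close>, hence
  starts there.\<close>

lemma balanced_reachable_sym:
  assumes fin: "finite V" and Y: "Y \<subseteq> V \<times> V"
    and bal: "\<And>v. card {u. (v, u) \<in> Y} = card {u. (u, v) \<in> Y}"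
    and uv: "(u, v) \<in> Y"
  shows "(v, u) \<in> Y\<^sup>*"
proof -
  define R where "R = V \<inter> Y\<^sup>* `` {v}"
  have finR: "finite R" using fin by (simp add: R_def)
  have fs: "finite {u. (w, u) \<in> Y}" "finite {u. (u, w) \<in> Y}" for w
    by (rule finite_subset[OF _ fin]; use Y in auto)+
  have fY: "finite Y" using finite_subset[OF Y] fin by simp
  have "{e \<in> Y. fst e \<in> R} = Sigma R (\<lambda>w. {u. (w, u) \<in> Y})" by auto
  then have 1: "card {e \<in> Y. fst e \<in> R} = (\<Sum>w\<in>R. card {u. (w, u) \<in> Y})"
    using finR fs by simp
  have "{e \<in> Y. snd e \<in> R} = prod.swap ` Sigma R (\<lambda>w. {u. (u, w) \<in> Y})" by auto
  then have 2: "card {e \<in> Y. snd e \<in> R} = (\<Sum>w\<in>R. card {u. (u, w) \<in> Y})"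
    using finR fs by (simp add: card_image)
  have "{e \<in> Y. fst e \<in> R} \<subseteq> {e \<in> Y. snd e \<in> R}"
    using Y by (auto simp: R_def intro: rtrancl_into_rtrancl)
  moreover have "card {e \<in> Y. fst e \<in> R} = card {e \<in> Y. snd e \<in> R}"
    unfolding 1 2 using bal by simp
  ultimately have "{e \<in> Y. fst e \<in> R} = {e \<in> Y. snd e \<in> R}"
    using fY by (intro card_subset_eq) auto
  moreover have "(u, v) \<in> {e \<in> Y. snd e \<in> R}" using uv Y by (auto simp: R_def)
  ultimately have "(u, v) \<in> {e \<in> Y. fst e \<in> R}" by simp
  then have "u \<in> R" by simp
  then show ?thesis by (simp add: R_def)
qed

text \<open>A balanced digraph is strongly connected on each component; a shortest-path
  out-tree uses at most all out-arcs and one in-arc at each vertex.\<close>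

lemma balanced_forest:
  assumes fin: "finite V" and Y: "Y \<subseteq> V \<times> V"
    and bal: "\<And>v. card {u. (v, u) \<in> Y} = card {u. (u, v) \<in> Y}"
  obtains F where "F \<subseteq> ed ` Y" "\<And>v. vdeg F v \<le> card {u. (v, u) \<in> Y} + 1"
    "\<And>u v. (u, v) \<in> Y \<Longrightarrow> (u, v) \<in> {(a, b). {a, b} \<in> F}\<^sup>*"
proof -
  have "sym (Y\<^sup>*)"
  proof (rule symI)
    fix a b assume "(a, b) \<in> Y\<^sup>*"
    then show "(b, a) \<in> Y\<^sup>*"
      by (induction rule: rtrancl_induct)
        (auto intro: balanced_reachable_sym[OF fin Y bal] rtrancl_trans)
  qed
  \<comment> \<open>A root for each component: vertices that reach the same vertices give the same
    predicate and hence the same choice.\<close>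
  define \<rho> where "\<rho> v = (SOME x. (v, x) \<in> Y\<^sup>*)" for v
  have \<rho>: "(\<rho> v, v) \<in> Y\<^sup>*" for v
  proof -
    have "(v, \<rho> v) \<in> Y\<^sup>*" unfolding \<rho>_def by (rule someI[of _ v]) simp
    then show ?thesis using \<open>sym (Y\<^sup>*)\<close> by (meson symD)
  qed
  have \<rho>_eq: "\<rho> u = \<rho> v" if "(u, v) \<in> Y\<^sup>*" for u v
  proof -
    have "(u, x) \<in> Y\<^sup>* \<longleftrightarrow> (v, x) \<in> Y\<^sup>*" for x
      using that \<open>sym (Y\<^sup>*)\<close> by (meson rtrancl_trans symD)
    then show ?thesis by (simp add: \<rho>_def)
  qed
  define dist where "dist v = (LEAST k. (\<rho> v, v) \<in> Y ^^ k)" for v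
  have dist: "(\<rho> v, v) \<in> Y ^^ dist v" for v
    unfolding dist_def by (rule LeastI_ex) (use \<rho>[of v] rtrancl_power in blast)
  have "\<exists>p. (p, v) \<in> Y \<and> dist p < dist v" if v: "v \<noteq> \<rho> v" for v
  proof -
    obtain k where k: "dist v = Suc k" using dist[of v] v by (cases "dist v") auto
    then obtain p where p: "(\<rho> v, p) \<in> Y ^^ k" "(p, v) \<in> Y"
      using dist[of v] by auto
    then have "\<rho> p = \<rho> v" using \<rho>_eq[of p v] by auto
    then have "dist p \<le> k" unfolding dist_def using p by (intro Least_le) simp
    then show ?thesis using p k by auto
  qed
  then obtain \<pi> where \<pi>: "\<And>v. v \<noteq> \<rho> v \<Longrightarrow> (\<pi> v, v) \<in> Y \<and> dist (\<pi> v) < dist v" by metis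
  \<comment> \<open>Each vertex other than a root contributes the pair to its parent
    \<open>\<pi> v\<close>. A vertex outside \<open>V\<close> has no arcs and is its own
    root.\<close>
  define F where "F = (\<lambda>v. {\<pi> v, v}) ` {v. v \<noteq> \<rho> v}"
  let ?R = "{(a, b). {a, b} \<in> F}"
  have "sym (?R\<^sup>*)" by (intro sym_rtrancl) (auto simp: sym_def insert_commute)
  have root: "(\<rho> v, v) \<in> ?R\<^sup>*" for v
  proof (induction "dist v" arbitrary: v rule: less_induct)
    case less
    show ?case
    proof (cases "v = \<rho> v")
      case False
      have "(\<rho> (\<pi> v), \<pi> v) \<in> ?R\<^sup>*" using less[of "\<pi> v"] \<pi>[OF False] by blast
      moreover have "\<rho> (\<pi> v) = \<rho> v" using \<pi>[OF False] \<rho>_eq[of "\<pi> v" v] by blast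
      ultimately have "(\<rho> v, \<pi> v) \<in> ?R\<^sup>*" by simp
      moreover have "(\<pi> v, v) \<in> ?R" using False by (auto simp: F_def)
      ultimately show ?thesis by (rule rtrancl_into_rtrancl)
    next
      case True
      then have "?R\<^sup>* `` {\<rho> v} = ?R\<^sup>* `` {v}" by simp
      then show ?thesis by blast
    qed
  qed
  show ?thesis
  proof
    show "F \<subseteq> ed ` Y"
    proof
      fix p assume "p \<in> F"
      then obtain v where "v \<noteq> \<rho> v" "p = ed (\<pi> v, v)" by (auto simp: F_def)
      then show "p \<in> ed ` Y" using \<pi> by blast
    qed
    show "(u, v) \<in> ?R\<^sup>*" if "(u, v) \<in> Y" for u v
    proof -
      have "\<rho> u = \<rho> v" using \<rho>_eq that by blast
      then have "(\<rho> u, v) \<in> ?R\<^sup>*" using root[of v] by simp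
      then show ?thesis by (rule rtrancl_trans[OF symD[OF \<open>sym (?R\<^sup>*)\<close> root]])
    qed
    show "vdeg F v \<le> card {u. (v, u) \<in> Y} + 1" for v
    proof -
      have fs: "finite {u. (v, u) \<in> Y}" by (rule finite_subset[OF _ fin]) (use Y in auto)
      \<comment> \<open>The pair to the parent, and pairs to children, which are out-neighbours of
        \<open>v\<close>. At a root \<open>\<pi> v\<close> is arbitrary, which only enlarges the
        upper bound.\<close>
      have "{p \<in> F. v \<in> p} \<subseteq> insert {\<pi> v, v} ((\<lambda>u. {v, u}) ` {u. (v, u) \<in> Y})"
        using \<pi> by (auto simp: F_def)
      then have "vdeg F v \<le> card (insert {\<pi> v, v} ((\<lambda>u. {v, u}) ` {u. (v, u) \<in> Y}))"
        unfolding vdeg_def using fs by (intro card_mono) auto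
      also have "\<dots> \<le> Suc (card ((\<lambda>u. {v, u}) ` {u. (v, u) \<in> Y}))"
        by (rule card_insert_le_m1) auto
      also have "\<dots> \<le> card {u. (v, u) \<in> Y} + 1" using fs card_image_le by auto
      finally show ?thesis .
    qed
  qed
qed

lemma vdeg_outside: "P \<subseteq> pairs V \<Longrightarrow> v \<notin> V \<Longrightarrow> vdeg P v = 0"
  unfolding vdeg_def pairs_def by (auto simp: card_eq_0_iff)

text \<open>Below, \<open>od v\<close> is half the \<open>Q1\<close>-degree of \<open>v\<close>. The forest costs at most \<open>od v + 1\<close> of the
  underlying degree, which is \<open>\<sigma> + od v\<close>.\<close>

theorem hamilton_split:
  assumes fin: "finite V" and ev: "even (card V)" and n3: "3 \<le> card V"
    and X: "X \<subseteq> V \<times> V" "\<And>v. (v, v) \<notin> X"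
    and out: "\<And>v. v \<in> V \<Longrightarrow> card {u. (v, u) \<in> X} = \<sigma>"
    and inn: "\<And>v. v \<in> V \<Longrightarrow> card {u. (u, v) \<in> X} = \<sigma>"
    and \<sigma>: "card V + 30 \<le> 2 * \<sigma>"
    and Z: "\<And>p. p \<in> Z \<Longrightarrow> \<exists>u v. p = {u, v} \<and> (u, v) \<in> X \<and> (v, u) \<in> X" "3 * card Z \<le> card V"
  obtains H A B where "ham V H" "A \<subseteq> pairs V" "B \<subseteq> pairs V"
    "\<And>v. v \<in> V \<Longrightarrow> vdeg A v = \<sigma> - 1" "\<And>v. v \<in> V \<Longrightarrow> vdeg B v = \<sigma> - 1" "H \<inter> Z = {}"
    "\<And>u v. u \<noteq> v \<Longrightarrow> (of_bool ({u, v} \<in> H) + of_bool ({u, v} \<in> A) + of_bool ({u, v} \<in> B) :: nat)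
      = of_bool ((u, v) \<in> X) + of_bool ((v, u) \<in> X)"
proof -
  define Y where "Y = {(u, v). (u, v) \<in> X \<and> (v, u) \<notin> X}"
  define D where "D = {(u, v). (u, v) \<in> X \<and> (v, u) \<in> X}"
  define Q1 where "Q1 = ed ` Y"
  define Q2 where "Q2 = ed ` D"
  have Q1: "{u, v} \<in> Q1 \<longleftrightarrow> (u, v) \<in> Y \<or> (v, u) \<in> Y" for u v
    unfolding Q1_def by (rule pair_in_ed_image)
  have Q2: "{u, v} \<in> Q2 \<longleftrightarrow> (u, v) \<in> D" for u v
    unfolding Q2_def by (simp add: pair_in_ed_image D_def conj_commute)
  have Q1p: "Q1 \<subseteq> pairs V"
  proof
    fix p assume "p \<in> Q1"
    then obtain u v where "p = {u, v}" "(u, v) \<in> Y" by (auto simp: Q1_def)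
    then show "p \<in> pairs V" using X by (auto simp: Y_def)
  qed
  have Q2p: "Q2 \<subseteq> pairs V"
  proof
    fix p assume "p \<in> Q2"
    then obtain u v where uv: "p = {u, v}" "(u, v) \<in> X" by (auto simp: Q2_def D_def)
    then have "u \<noteq> v" using X by blast
    then show "p \<in> pairs V" using X uv by auto
  qed
  have disj: "Q1 \<inter> Q2 = {}" by (auto simp: Q1_def Q2 Y_def D_def)
  have fQ: "finite Q1" "finite Q2" using finite_pairs_subset[OF fin] Q1p Q2p by blast+
  have fs: "finite {u. (v, u) \<in> X}" "finite {u. (u, v) \<in> X}" for v
    by (rule finite_subset[OF _ fin]; use X in auto)+
  define od where "od v = card {u. (v, u) \<in> Y}" for v
  have outY: "od v + vdeg Q2 v = card {u. (v, u) \<in> X}"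
    and inY: "card {u. (u, v) \<in> Y} + vdeg Q2 v = card {u. (u, v) \<in> X}" for v
  proof -
    have d2: "vdeg Q2 v = card {u. (v, u) \<in> D}" by (simp add: vdeg_nb[OF Q2p] Q2)
    have "{u. (v, u) \<in> X} = {u. (v, u) \<in> Y} \<union> {u. (v, u) \<in> D}" by (auto simp: Y_def D_def)
    moreover have "card \<dots> = card {u. (v, u) \<in> Y} + card {u. (v, u) \<in> D}"
      using fs[of v] by (intro card_Un_disjoint) (auto simp: Y_def D_def intro: finite_subset)
    ultimately show "od v + vdeg Q2 v = card {u. (v, u) \<in> X}" using d2 by (simp add: od_def)
    have "{u. (u, v) \<in> X} = {u. (u, v) \<in> Y} \<union> {u. (v, u) \<in> D}" by (auto simp: Y_def D_def)
    moreover have "card \<dots> = card {u. (u, v) \<in> Y} + card {u. (v, u) \<in> D}"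
      using fs[of v] by (intro card_Un_disjoint) (auto simp: Y_def D_def intro: finite_subset)
    ultimately show "card {u. (u, v) \<in> Y} + vdeg Q2 v = card {u. (u, v) \<in> X}" using d2 by simp
  qed
  have empty: "{u. (v, u) \<in> X} = {}" "{u. (u, v) \<in> X} = {}" if "v \<notin> V" for v
    using X that by auto
  have odi: "od v = card {u. (u, v) \<in> Y}" for v
  proof (cases "v \<in> V")
    case True
    then show ?thesis using outY[of v] inY[of v] out[of v] inn[of v] by simp
  next
    case False
    then show ?thesis using outY[of v] inY[of v] empty[of v] by simp
  qed
  have d1: "vdeg Q1 v = 2 * od v" for v
  proof -
    have "{u. {v, u} \<in> Q1} = {u. (v, u) \<in> Y} \<union> {u. (u, v) \<in> Y}" by (auto simp: Q1)
    moreover have "card \<dots> = card {u. (v, u) \<in> Y} + card {u. (u, v) \<in> Y}"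
      using fs[of v] by (intro card_Un_disjoint) (auto simp: Y_def intro: finite_subset)
    ultimately show ?thesis using odi[of v] by (simp add: vdeg_nb[OF Q1p] od_def)
  qed
  have YV: "Y \<subseteq> V \<times> V" using X by (auto simp: Y_def)
  obtain F where F: "F \<subseteq> Q1" "\<And>v. vdeg F v \<le> od v + 1"
      "\<And>u v. (u, v) \<in> Y \<Longrightarrow> (u, v) \<in> {(a, b). {a, b} \<in> F}\<^sup>*"
    unfolding Q1_def od_def
    by (rule balanced_forest[OF fin YV]) (use odi in \<open>auto simp: od_def\<close>)
  have ZQ: "Z \<subseteq> Q2"
  proof
    fix p assume "p \<in> Z"
    then obtain u v where "p = {u, v}" "(u, v) \<in> X" "(v, u) \<in> X" using Z(1) by blast
    then show "p \<in> Q2" by (simp add: Q2 D_def)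
  qed
  have fZ: "finite Z" using ZQ fQ finite_subset by blast
  define E where "E = (Q1 - F) \<union> (Q2 - Z)"
  have Ep: "E \<subseteq> pairs V" using Q1p Q2p by (auto simp: E_def)
  have dE: "\<sigma> \<le> vdeg E v + vdeg Z v + 1" if "v \<in> V" for v
  proof -
    have "vdeg E v = vdeg (Q1 - F) v + vdeg (Q2 - Z) v"
      unfolding E_def using fQ disj by (intro vdeg_union) auto
    moreover have "od v + vdeg Q2 v = \<sigma>" using outY out that by simp
    ultimately show ?thesis
      using vdeg_diff[OF fQ(1) F(1), of v] vdeg_diff[OF fQ(2) ZQ, of v] d1[of v] F(2)[of v] by linarith
  qed
  \<comment> \<open>With at most 14 pairs of \<open>Z\<close> at \<open>v\<close>, \<open>dE\<close>
    leaves degree at least \<open>\<sigma> - 15\<close>, just enough for Dirac. Counting ends,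
    \<open>15 * card W\<close> is at most \<open>2 * card Z\<close>, so the exceptional set is
    small.\<close>
  define W where "W = {v \<in> V. 15 \<le> vdeg Z v}"
  have fW: "finite W" using fin by (simp add: W_def)
  have "15 * card W = (\<Sum>v\<in>W. 15)" by simp
  also have "\<dots> \<le> (\<Sum>v\<in>W. vdeg Z v)" by (intro sum_mono) (simp add: W_def)
  also have "\<dots> \<le> (\<Sum>v\<in>V. vdeg Z v)" using fin by (intro sum_mono2) (auto simp: W_def)
  also have "\<dots> = 2 * card Z" using handshake[OF fin, of Z] ZQ Q2p by auto
  finally have cW: "15 * card W \<le> 2 * card Z" .
  have "\<exists>H. ham V H \<and> H \<subseteq> E"
  proof (rule ham_exists[OF fin n3 Ep])
    show "W \<subseteq> V" by (auto simp: W_def)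
    show "2 * card W \<le> card V" using cW Z(2) by linarith
    show "card V \<le> 2 * vdeg E v" if "v \<in> V - W" for v
      using dE[of v] that \<sigma> by (auto simp: W_def)
    \<comment> \<open>Even if all of \<open>Z\<close> meets \<open>v\<close>, about a sixth of
      \<open>card V\<close> neighbours remain, while \<open>card W\<close> is at most
      \<open>2/45\<close> of \<open>card V\<close>.\<close>
    show "card W < vdeg E v" if "v \<in> W" for v
    proof -
      have "vdeg Z v \<le> card Z" unfolding vdeg_def using fZ by (intro card_mono) auto
      then show ?thesis using dE[of v] that \<sigma> cW Z(2) by (auto simp: W_def)
    qed
  qed
  then obtain H where H: "ham V H" "H \<subseteq> E" by blast
  have Hp: "H \<subseteq> pairs V" using H Ep by blast
  have fH: "finite H" using finite_pairs_subset[OF fin Hp] .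
  have dH: "vdeg H v = 2" if "v \<in> V" for v using ham_facts(3)[OF H(1) fin that] .
  have HF: "H \<inter> F = {}" "H \<inter> Z = {}" "H \<subseteq> Q1 \<union> Q2"
    using H(2) F(1) ZQ disj by (auto simp: E_def)
  \<comment> \<open>The pairs of which exactly one copy is left after the removal of
    \<open>H\<close>. Those of \<open>Q2 - H\<close> still have two copies and go to both
    parts.\<close>
  define S where "S = (Q1 - H) \<union> (Q2 \<inter> H)"
  have Sp: "S \<subseteq> pairs V" using Q1p Q2p by (auto simp: S_def)
  have fS: "finite S" using finite_pairs_subset[OF fin Sp] .
  have hh: "vdeg H v = vdeg (Q1 \<inter> H) v + vdeg (Q2 \<inter> H) v" for v
  proof -
    have "H = (Q1 \<inter> H) \<union> (Q2 \<inter> H)" using HF by blast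
    moreover have "vdeg \<dots> v = vdeg (Q1 \<inter> H) v + vdeg (Q2 \<inter> H) v"
      using fH disj by (intro vdeg_union) auto
    ultimately show ?thesis by simp
  qed
  have dS: "vdeg S v + vdeg (Q1 \<inter> H) v = 2 * od v + vdeg (Q2 \<inter> H) v" for v
  proof -
    have "vdeg S v = vdeg (Q1 - H) v + vdeg (Q2 \<inter> H) v"
      unfolding S_def using fQ disj by (intro vdeg_union) auto
    moreover have "Q1 - H = Q1 - (Q1 \<inter> H)" by blast
    ultimately show ?thesis using vdeg_diff[OF fQ(1), of "Q1 \<inter> H" v] d1[of v] by simp
  qed
  have evS: "even (vdeg S v)" for v
  proof (cases "v \<in> V")
    case True
    then show ?thesis using dS[of v] hh[of v] dH[of v] by presburger
  next
    case False
    then show ?thesis using vdeg_outside[OF Sp] by simp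
  qed
  \<comment> \<open>\<open>H\<close> connects \<open>V\<close>. Its edges in \<open>Q2\<close> lie
    in \<open>S\<close>, and each edge in \<open>Q1\<close> is bypassed by a path of the forest,
    which avoids \<open>H\<close> and so lies in \<open>S\<close>.\<close>
  have conn: "(u, v) \<in> {(a, b). {a, b} \<in> S}\<^sup>*" if uv: "u \<in> V" "v \<in> V" for u v
  proof -
    let ?S = "{(a, b). {a, b} \<in> S}"
    have symS: "sym (?S\<^sup>*)" by (intro sym_rtrancl) (auto simp: sym_def insert_commute)
    have "{(a, b). {a, b} \<in> F} \<subseteq> ?S" using F(1) HF by (auto simp: S_def)
    then have FS: "(a, b) \<in> ?S\<^sup>*" if "(a, b) \<in> Y" for a b
      using F(3)[OF that] rtrancl_mono by blast
    have "{(a, b). {a, b} \<in> H} \<subseteq> ?S\<^sup>*"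
    proof clarify
      fix a b assume ab: "{a, b} \<in> H"
      show "(a, b) \<in> ?S\<^sup>*"
      proof (cases "{a, b} \<in> Q1")
        case True
        then show ?thesis using FS symS by (auto simp: Q1 dest: symD)
      next
        case False
        then have "{a, b} \<in> S" using ab HF by (auto simp: S_def)
        then show ?thesis by auto
      qed
    qed
    then have "{(a, b). {a, b} \<in> H}\<^sup>* \<subseteq> ?S\<^sup>*" by (rule rtrancl_subset_rtrancl)
    then show ?thesis using ham_facts(4)[OF H(1) fin uv] by blast
  qed
  \<comment> \<open>Counting the edges left without \<open>H\<close> shows that
    \<open>card S\<close> has the parity of \<open>card V * (\<sigma> + 1)\<close>.\<close>
  have "even (card S)"
  proof -
    have "vdeg S v + 2 * vdeg (Q1 \<inter> H) v + 2 * vdeg Q2 v = 2 * (\<sigma> + 1)" if "v \<in> V" for v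
      using dS[of v] hh[of v] dH[OF that] outY[of v] out[OF that] by presburger
    then have "(\<Sum>v\<in>V. vdeg S v + 2 * vdeg (Q1 \<inter> H) v + 2 * vdeg Q2 v) = card V * (2 * (\<sigma> + 1))"
      by simp
    then have "2 * card S + 2 * (2 * card (Q1 \<inter> H)) + 2 * (2 * card Q2) = card V * (2 * (\<sigma> + 1))"
      using handshake[OF fin Sp] handshake[OF fin, of "Q1 \<inter> H"] handshake[OF fin Q2p] Q1p
      by (simp add: sum.distrib le_infI1 flip: sum_distrib_left)
    then have "card S + 2 * (card (Q1 \<inter> H) + card Q2) = card V * (\<sigma> + 1)" by simp
    then show ?thesis using ev by (metis dvd_add_left_iff dvd_triv_left even_mult_iff)
  qed
  moreover have "V \<noteq> {}" using n3 by auto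
  ultimately obtain T where T: "T \<subseteq> S" "\<And>v. 2 * vdeg T v = vdeg S v"
    using balanced_halving[OF fin Sp evS conn] by blast
  have "vdeg (S - T) v = vdeg T v" for v
    using vdeg_diff[OF fS T(1), of v] T(2)[of v] by simp
  then have half: "2 * vdeg T' v = vdeg S v" if "T' = T \<or> T' = S - T" for T' v
    using that T(2) by auto
  have part: "vdeg ((Q2 - H) \<union> T') v = \<sigma> - 1" if T': "T' = T \<or> T' = S - T" and v: "v \<in> V" for T' v
  proof -
    have "T' \<subseteq> S" using T' T by auto
    then have "vdeg ((Q2 - H) \<union> T') v = vdeg (Q2 - H) v + vdeg T' v"
      using fQ fS disj by (intro vdeg_union) (auto simp: S_def intro: finite_subset)
    moreover have "vdeg (Q2 - H) v = vdeg (Q2 - (Q2 \<inter> H)) v" by (simp add: Diff_Int)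
    ultimately show ?thesis
      using vdeg_diff[OF fQ(2), of "Q2 \<inter> H" v] half[OF T', of v] dS[of v] hh[of v] dH[OF v]
        outY[of v] out[OF v] by simp
  qed
  show ?thesis
  proof
    show "ham V H" by (rule H(1))
    show "(Q2 - H) \<union> T \<subseteq> pairs V" "(Q2 - H) \<union> (S - T) \<subseteq> pairs V" using Q2p Sp T by auto
    show "vdeg ((Q2 - H) \<union> T) v = \<sigma> - 1" "vdeg ((Q2 - H) \<union> (S - T)) v = \<sigma> - 1" if "v \<in> V" for v
      using part that by auto
    show "H \<inter> Z = {}" by (rule HF(2))
    fix u v :: 'a assume "u \<noteq> v"
    have cnt: "of_bool (p \<in> H) + of_bool (p \<in> (Q2 - H) \<union> T) + of_bool (p \<in> (Q2 - H) \<union> (S - T)) =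
      (of_bool (p \<in> Q1) + 2 * of_bool (p \<in> Q2) :: nat)" for p
    proof -
      have "p \<notin> Q1 \<or> p \<notin> Q2" "p \<in> H \<Longrightarrow> p \<in> Q1 \<or> p \<in> Q2" "p \<in> T \<Longrightarrow> p \<in> S"
        using disj HF(3) T(1) by blast+
      then show ?thesis
        by (cases "p \<in> Q1"; cases "p \<in> Q2"; cases "p \<in> H"; cases "p \<in> T") (auto simp: S_def)
    qed
    show "of_bool ({u, v} \<in> H) + of_bool ({u, v} \<in> (Q2 - H) \<union> T) + of_bool ({u, v} \<in> (Q2 - H) \<union> (S - T)) =
      (of_bool ((u, v) \<in> X) + of_bool ((v, u) \<in> X) :: nat)"
      unfolding cnt by (auto simp: Q1 Q2 Y_def D_def)
  qed
qed

subsection \<open>Multiplicities\<close>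

definition mdeg :: "'v set \<Rightarrow> ('v set \<Rightarrow> nat) \<Rightarrow> 'v \<Rightarrow> nat" where
  "mdeg V m v = (\<Sum>p | p \<in> pairs V \<and> v \<in> p. m p)"

text \<open>A list of simple graphs stands for the multigraph in which they are edge-disjoint, and
  this is its multiplicity function. An identity \<open>m p = cover Ps p\<close> on all pairs is
  thus a decomposition up to the naming of parallel edges.\<close>

definition cover :: "'v set set list \<Rightarrow> 'v set \<Rightarrow> nat" where
  "cover Ps p = length (filter (\<lambda>P. p \<in> P) Ps)"

lemma cover_simps [simp]:
  "cover [] p = 0" "cover (P # Ps) p = of_bool (p \<in> P) + cover Ps p"
  "cover (Ps @ Qs) p = cover Ps p + cover Qs p"
  by (simp_all add: cover_def)

lemma length_filter_Cons: "length (filter Q (x # xs)) = of_bool (Q x) + length (filter Q xs)"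
  by simp

lemma mdeg_nb: "v \<in> V \<Longrightarrow> mdeg V m v = (\<Sum>u\<in>V - {v}. m {v, u})"
  unfolding mdeg_def by (rule sum_star)

lemma mdeg_add: "mdeg V (\<lambda>p. f p + g p) v = mdeg V f v + mdeg V g v"
  by (simp add: mdeg_def sum.distrib)

lemma mdeg_cong: "(\<And>p. p \<in> pairs V \<Longrightarrow> f p = g p) \<Longrightarrow> mdeg V f v = mdeg V g v"
  unfolding mdeg_def by (rule sum.cong) auto

lemma mdeg_of_bool:
  assumes "finite V" "P \<subseteq> pairs V"
  shows "mdeg V (\<lambda>p. of_bool (p \<in> P)) v = vdeg P v"
proof -
  have "finite {p. p \<in> pairs V \<and> v \<in> p}" using finite_pairs[OF assms(1)] by simp
  then have "mdeg V (\<lambda>p. of_bool (p \<in> P)) v = card ({p. p \<in> pairs V \<and> v \<in> p} \<inter> {p. p \<in> P})"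
    by (simp add: mdeg_def of_bool_def sum.If_cases)
  moreover have "{p. p \<in> pairs V \<and> v \<in> p} \<inter> {p. p \<in> P} = {p \<in> P. v \<in> p}" using assms by blast
  ultimately show ?thesis by (simp add: vdeg_def)
qed

text \<open>Indicator sums over \<open>V - {w}\<close> combine directly with the expression of
  \<open>mdeg\<close> as a sum over neighbours.\<close>

lemma balanced_orientation_sums:
  assumes fin: "finite V" and E: "E \<subseteq> pairs V" and even: "\<And>w. even (vdeg E w)"
  obtains A where "\<And>a b. {a, b} \<in> E \<longleftrightarrow> (a, b) \<in> A \<or> (b, a) \<in> A" "\<And>a b. (a, b) \<in> A \<Longrightarrow> (b, a) \<notin> A"
    "\<And>w. (\<Sum>u\<in>V - {w}. of_bool ((w, u) \<in> A) :: nat) = (\<Sum>u\<in>V - {w}. of_bool ((u, w) \<in> A))"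
proof -
  obtain A where A: "\<forall>a b. {a, b} \<in> E \<longleftrightarrow> (a, b) \<in> A \<or> (b, a) \<in> A" "\<forall>a b. (a, b) \<in> A \<longrightarrow> (b, a) \<notin> A"
    "\<forall>w. card {e \<in> A. fst e = w} = card {e \<in> A. snd e = w}"
    using balanced_orientation[OF assms] by blast
  have AV: "a \<in> V \<and> b \<in> V \<and> a \<noteq> b" if "(a, b) \<in> A" for a b
  proof -
    have "{a, b} \<in> pairs V" using A(1) that E by blast
    then show ?thesis by simp
  qed
  have 1: "(\<Sum>u\<in>V - {w}. of_bool ((w, u) \<in> A)) = card {e \<in> A. fst e = w}" for w
  proof -
    have "{e \<in> A. fst e = w} = Pair w ` ((V - {w}) \<inter> {u. (w, u) \<in> A})" using AV by force
    then show ?thesis using fin by (simp add: of_bool_def sum.If_cases card_image inj_on_def)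
  qed
  have 2: "(\<Sum>u\<in>V - {w}. of_bool ((u, w) \<in> A)) = card {e \<in> A. snd e = w}" for w
  proof -
    have "{e \<in> A. snd e = w} = (\<lambda>u. (u, w)) ` ((V - {w}) \<inter> {u. (u, w) \<in> A})" using AV by force
    then show ?thesis using fin by (simp add: of_bool_def sum.If_cases card_image inj_on_def)
  qed
  show ?thesis by (rule that[of A]) (use A 1 2 in auto)
qed

text \<open>There are more subsets of a large \<open>J\<close> than parity vectors, so two of them have
  an even symmetric difference, which can be removed from \<open>J\<close>.\<close>

lemma even_complement:
  assumes fin: "finite V" and P: "P \<subseteq> pairs V"
  obtains J where "J \<subseteq> P" "card J \<le> card V" "\<And>v. even (vdeg (P - J) v)"
proof -
  have fP: "finite P" using finite_pairs_subset[OF fin P] .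
  define ok where "ok J \<longleftrightarrow> J \<subseteq> P \<and> (\<forall>v. even (vdeg (P - J) v))" for J
  have "ok P" by (simp add: ok_def)
  then obtain J where J: "ok J" and min: "\<And>J'. ok J' \<Longrightarrow> card J \<le> card J'"
    using ex_has_least_nat[of ok P card] by blast
  have JP: "J \<subseteq> P" using J by (simp add: ok_def)
  have fJ: "finite J" using JP fP finite_subset by blast
  have "card J \<le> card V"
  proof (rule ccontr)
    assume "\<not> card J \<le> card V"
    define g where "g S = {v \<in> V. odd (vdeg S v)}" for S
    have "card (Pow V) < card (Pow J)"
      using \<open>\<not> card J \<le> card V\<close> fin fJ by (simp add: card_Pow)
    moreover have "g ` Pow J \<subseteq> Pow V" by (auto simp: g_def)
    ultimately have "\<not> inj_on g (Pow J)"
      using card_inj_on_le[of g "Pow J" "Pow V"] fin by auto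
    then obtain S T where ST: "S \<subseteq> J" "T \<subseteq> J" "g S = g T" "S \<noteq> T" by (auto simp: inj_on_def)
    have f: "finite S" "finite T" using ST fJ finite_subset by blast+
    define D where "D = (S - T) \<union> (T - S)"
    have DJ: "D \<subseteq> J" "D \<noteq> {}" using ST by (auto simp: D_def)
    have "even (vdeg D v)" for v
    proof -
      have "vdeg D v = vdeg (S - (S \<inter> T)) v + vdeg (T - (S \<inter> T)) v"
        unfolding D_def Diff_Int using f by (subst vdeg_union) auto
      moreover have "even (vdeg S v) \<longleftrightarrow> even (vdeg T v)"
      proof (cases "v \<in> V")
        case True
        then have "v \<in> g S \<longleftrightarrow> v \<in> g T" using ST by simp
        then show ?thesis using True by (simp add: g_def)
      next
        case False
        then show ?thesis using vdeg_outside[of S V v] vdeg_outside[of T V v] ST JP P by auto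
      qed
      ultimately show ?thesis
        using vdeg_diff[OF f(1), of "S \<inter> T" v] vdeg_diff[OF f(2), of "S \<inter> T" v] by auto
    qed
    moreover have "P - (J - D) = (P - J) \<union> D" using DJ JP by blast
    moreover have "vdeg ((P - J) \<union> D) v = vdeg (P - J) v + vdeg D v" for v
      using fP f DJ by (intro vdeg_union) (auto simp: D_def)
    ultimately have "ok (J - D)" using J by (auto simp: ok_def)
    then have "card J \<le> card (J - D)" by (rule min)
    moreover have "card (J - D) < card J" using DJ fJ by (intro psubset_card_mono) auto
    ultimately show False by simp
  qed
  then show ?thesis using that[of J] J by (auto simp: ok_def)
qed

lemma card_arcs:
  assumes "finite V" "P \<subseteq> pairs V"
  shows "card {(u, v). {u, v} \<in> P} = 2 * card P"
proof -
  have "{(u, v). {u, v} \<in> P} = Sigma V (\<lambda>u. {v. {u, v} \<in> P})" using assms(2) by auto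
  moreover have "finite {v. {u, v} \<in> P}" for u
    by (rule finite_subset[OF _ assms(1)]) (use assms(2) in auto)
  ultimately have "card {(u, v). {u, v} \<in> P} = (\<Sum>u\<in>V. vdeg P u)"
    using assms by (simp add: vdeg_nb)
  then show ?thesis using handshake[OF assms] by simp
qed

text \<open>A pair of multiplicity one may not be used by both \<open>H\<close> and \<open>A\<close>, hence should not be a double
  pair unless \<open>H\<close> avoids it. So such pairs are weighted \<open>2\<close> in one direction only, along an Eulerian
  orientation; the exceptional set \<open>J\<close> needed for parity is small, and the cost bound of the rounding
  makes at most \<open>card V / 3\<close> of its pairs double.\<close>

theorem extract_full:
  assumes fin: "finite V" and ev: "even (card V)" and n3: "3 \<le> card V"
    and m: "\<And>p. p \<in> pairs V \<Longrightarrow> m p \<le> r" and r: "3 \<le> r"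
    and deg: "\<And>v. v \<in> V \<Longrightarrow> mdeg V m v = r * s" and s: "card V + 30 \<le> 2 * s"
  obtains H A where "ham V H" "A \<subseteq> pairs V" "\<And>v. v \<in> V \<Longrightarrow> vdeg A v = s - 1"
    "\<And>p. p \<in> pairs V \<Longrightarrow> of_bool (p \<in> H) + of_bool (p \<in> A) \<le> m p"
    "\<And>p. p \<in> pairs V \<Longrightarrow> m p \<le> r - 1 + of_bool (p \<in> H) + of_bool (p \<in> A)"
proof -
  define O1 where "O1 = {p \<in> pairs V. m p = 1}"
  have O1p: "O1 \<subseteq> pairs V" by (auto simp: O1_def)
  obtain J where J: "J \<subseteq> O1" "card J \<le> card V" "\<And>v. even (vdeg (O1 - J) v)"
    using even_complement[OF fin O1p] by blast
  have Ep: "O1 - J \<subseteq> pairs V" using O1p by auto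
  obtain Ar where Ar: "\<And>a b. {a, b} \<in> O1 - J \<longleftrightarrow> (a, b) \<in> Ar \<or> (b, a) \<in> Ar"
      "\<And>a b. (a, b) \<in> Ar \<Longrightarrow> (b, a) \<notin> Ar"
      "\<And>w. (\<Sum>u\<in>V - {w}. of_bool ((w, u) \<in> Ar) :: nat) = (\<Sum>u\<in>V - {w}. of_bool ((u, w) \<in> Ar))"
    using balanced_orientation_sums[OF fin Ep J(3)] by metis
  define M where "M u v = (if u = v then 0 else if {u, v} \<in> O1 - J then 2 * of_bool ((u, v) \<in> Ar)
    else m {u, v})" for u v
  \<comment> \<open>\<open>M\<close> is \<open>m\<close> plus the indicator of \<open>Ar\<close>
    minus that of its reverse, written without subtraction. Balance of \<open>Ar\<close> cancels
    these corrections in every row and column sum.\<close>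
  have M: "M u v + of_bool ((v, u) \<in> Ar) = m {u, v} + of_bool ((u, v) \<in> Ar)" if "u \<noteq> v" for u v
  proof (cases "{u, v} \<in> O1 - J")
    case True
    then have "m {u, v} = 1" by (auto simp: O1_def)
    then show ?thesis using that True Ar(1)[of u v] Ar(2)[of u v] Ar(2)[of v u]
      by (auto simp: M_def)
  next
    case False
    then show ?thesis using that Ar(1)[of u v] by (auto simp: M_def)
  qed
  have M': "M v u + of_bool ((u, v) \<in> Ar) = m {u, v} + of_bool ((v, u) \<in> Ar)" if "u \<noteq> v" for u v
    using M[of v u] that by (simp add: insert_commute)
  have sum_M: "(\<Sum>v\<in>V. M u v) = r * s" "(\<Sum>v\<in>V. M v u) = r * s" if u: "u \<in> V" for u
  proof -
    have md: "mdeg V m u = (\<Sum>v\<in>V - {u}. m {u, v})" using mdeg_nb[OF u] .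
    have "(\<Sum>v\<in>V. M u v) = (\<Sum>v\<in>V - {u}. M u v)"
      using u fin by (subst sum.remove[of _ u]) (auto simp: M_def)
    moreover have "(\<Sum>v\<in>V - {u}. M u v + of_bool ((v, u) \<in> Ar)) =
        (\<Sum>v\<in>V - {u}. m {u, v} + of_bool ((u, v) \<in> Ar))"
      by (intro sum.cong refl M) auto
    ultimately show "(\<Sum>v\<in>V. M u v) = r * s"
      using Ar(3)[of u] md deg[OF u] by (simp only: sum.distrib)
    have "(\<Sum>v\<in>V. M v u) = (\<Sum>v\<in>V - {u}. M v u)"
      using u fin by (subst sum.remove[of _ u]) (auto simp: M_def)
    moreover have "(\<Sum>v\<in>V - {u}. M v u + of_bool ((u, v) \<in> Ar)) =
        (\<Sum>v\<in>V - {u}. m {u, v} + of_bool ((v, u) \<in> Ar))"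
      by (intro sum.cong refl M') auto
    ultimately show "(\<Sum>v\<in>V. M v u) = r * s"
      using Ar(3)[of u] md deg[OF u] by (simp only: sum.distrib)
  qed
  have M_le: "M u v \<le> r" if "u \<in> V" "v \<in> V" for u v
    using m[of "{u, v}"] that r by (auto simp: M_def)
  define K where "K = {(u, v). {u, v} \<in> J}"
  have Jp: "J \<subseteq> pairs V" using J O1p by blast
  have KV: "K \<subseteq> V \<times> V" using Jp by (auto simp: K_def)
  have fK: "finite K" using finite_subset[OF KV] fin by simp
  have dvd: "r dvd (\<Sum>v\<in>V. M u v)" "r dvd (\<Sum>v\<in>V. M v u)" if "u \<in> V" for u
    using sum_M[OF that] by simp_all
  have r0: "0 < r" using r by simp
  obtain X where X: "X \<subseteq> V \<times> V" "\<And>i j. (i, j) \<in> X \<Longrightarrow> 0 < M i j"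
    "\<And>i j. i \<in> V \<Longrightarrow> j \<in> V \<Longrightarrow> M i j = r \<Longrightarrow> (i, j) \<in> X"
    "\<And>i. i \<in> V \<Longrightarrow> r * card {j. (i, j) \<in> X} = (\<Sum>j\<in>V. M i j)"
    "\<And>j. j \<in> V \<Longrightarrow> r * card {i. (i, j) \<in> X} = (\<Sum>i\<in>V. M i j)"
    "r * card (X \<inter> K) \<le> (\<Sum>(i, j)\<in>K. M i j)"
    using bipartite_rounding[OF fin fin r0 M_le dvd KV] by metis
  \<comment> \<open>Each pair of \<open>J\<close> keeps weight 1 in both directions, so
    \<open>K\<close> weighs \<open>2 * card J\<close>. A pair of \<open>Z\<close> takes two chosen
    cells of \<open>K\<close>, and \<open>r \<ge> 3\<close> gives the bound on
    \<open>Z\<close>.\<close>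
  have "(\<Sum>(i, j)\<in>K. M i j) = (\<Sum>e\<in>K. 1)"
    using J Jp by (intro sum.cong) (auto simp: K_def M_def O1_def)
  then have cK: "r * card (X \<inter> K) \<le> 2 * card V"
    using X(6) J(2) card_arcs[OF fin Jp] by (simp add: K_def)
  define Z where "Z = {p \<in> J. \<exists>u v. p = {u, v} \<and> (u, v) \<in> X \<and> (v, u) \<in> X}"
  have "{(u, v). {u, v} \<in> Z} \<subseteq> X \<inter> K" by (auto simp: Z_def K_def doubleton_eq_iff)
  then have "card {(u, v). {u, v} \<in> Z} \<le> card (X \<inter> K)" using fK by (intro card_mono) auto
  moreover have Zp: "Z \<subseteq> pairs V" using Jp by (auto simp: Z_def)
  ultimately have "2 * card Z \<le> card (X \<inter> K)" using card_arcs[OF fin Zp] by simp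
  then have "r * (2 * card Z) \<le> 2 * card V" using cK by (meson le_trans mult_le_mono2)
  moreover have "3 * (2 * card Z) \<le> r * (2 * card Z)" using r by (rule mult_le_mono1)
  ultimately have cZ: "3 * card Z \<le> card V" by linarith
  have ZX: "\<exists>u v. p = {u, v} \<and> (u, v) \<in> X \<and> (v, u) \<in> X" if "p \<in> Z" for p
    using that by (auto simp: Z_def)
  have irr: "(v, v) \<notin> X" for v using X(2)[of v v] by (auto simp: M_def)
  have out: "card {u. (v, u) \<in> X} = s" "card {u. (u, v) \<in> X} = s" if "v \<in> V" for v
    using X(4,5)[OF that] sum_M[OF that] r0 by simp_all
  \<comment> \<open>Only \<open>H\<close> and \<open>A\<close> are extracted; the edges of
    \<open>B\<close> stay in the remaining multigraph.\<close>
  obtain H A B where HAB: "ham V H" "A \<subseteq> pairs V" "\<And>v. v \<in> V \<Longrightarrow> vdeg A v = s - 1" "H \<inter> Z = {}"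
    "\<And>u v. u \<noteq> v \<Longrightarrow> (of_bool ({u, v} \<in> H) + of_bool ({u, v} \<in> A) + of_bool ({u, v} \<in> B) :: nat)
      = of_bool ((u, v) \<in> X) + of_bool ((v, u) \<in> X)"
    using hamilton_split[OF fin ev n3 X(1) irr out s ZX cZ] by metis
  have main: "of_bool (p \<in> H) + of_bool (p \<in> A) \<le> m p \<and>
      m p \<le> r - 1 + of_bool (p \<in> H) + of_bool (p \<in> A)" if p: "p \<in> pairs V" for p
  proof -
    obtain u v where uv: "p = {u, v}" "u \<in> V" "v \<in> V" "u \<noteq> v" using p by (rule pairsE)
    have mvu: "m {v, u} = m p" "{v, u} = p" using uv by (auto simp: insert_commute)
    have q: "(of_bool (p \<in> H) + of_bool (p \<in> A) + of_bool (p \<in> B) :: nat)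
      = of_bool ((u, v) \<in> X) + of_bool ((v, u) \<in> X)" using HAB(5)[OF uv(4)] uv by simp
    have pos: "0 < m p" if "(u, v) \<in> X \<or> (v, u) \<in> X"
      using that X(2)[of u v] X(2)[of v u] uv mvu
      by (auto simp: M_def O1_def split: if_splits)
    \<comment> \<open>If \<open>H\<close> and \<open>A\<close> share a pair, both its arcs were
      chosen. With multiplicity 1 it cannot be an oriented pair, one direction of which has weight
      0, so it lies in \<open>J\<close> and hence in \<open>Z\<close>, which \<open>H\<close>
      avoids.\<close>
    have two: "2 \<le> m p" if "p \<in> H" "p \<in> A"
    proof (rule ccontr)
      assume "\<not> 2 \<le> m p"
      have X2: "(u, v) \<in> X" "(v, u) \<in> X" using q that by (cases "(u, v) \<in> X"; cases "(v, u) \<in> X"; simp)+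
      then have "m p = 1" using pos \<open>\<not> 2 \<le> m p\<close> by linarith
      then have "p \<in> O1" using \<open>p \<in> pairs V\<close> by (simp add: O1_def)
      moreover have "p \<notin> O1 - J"
        using X(2)[OF X2(1)] X(2)[OF X2(2)] uv mvu Ar(2)[of u v]
        by (cases "(u, v) \<in> Ar") (auto simp: M_def split: if_splits)
      ultimately have "p \<in> Z" using X2 uv by (auto simp: Z_def)
      then show False using that HAB(4) by blast
    qed
    \<comment> \<open>Both directions have full weight \<open>r\<close>, so the rounding takes both;
      \<open>B\<close> can absorb only one of the two copies.\<close>
    have "p \<in> H \<or> p \<in> A" if "m p = r"
    proof -
      have "p \<notin> O1" using that r by (simp add: O1_def)
      then have "M u v = r" "M v u = r" using uv mvu that by (auto simp: M_def)
      then have "(u, v) \<in> X" "(v, u) \<in> X" using X(3) uv by auto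
      then show ?thesis using q by (cases "p \<in> H"; cases "p \<in> A"; cases "p \<in> B"; simp)
    qed
    moreover have "p \<in> H \<or> p \<in> A \<Longrightarrow> 0 < m p" using q pos by (cases "(u, v) \<in> X"; cases "(v, u) \<in> X") auto
    moreover have "m p \<le> r" using m p by blast
    ultimately show ?thesis using two by (cases "p \<in> H"; cases "p \<in> A"; cases "m p = r") auto
  qed
  show ?thesis by (rule that[OF HAB(1-3)]) (use main in auto)
qed

section \<open>Removing perfect matchings and splitting an even multiple\<close>

text \<open>Multiplicity at most \<open>\<rho>\<close> and degree at least
  \<open>\<rho> * \<sigma>\<close> force \<open>\<sigma>\<close> distinct neighbours. Dirac then
  gives a Hamilton cycle, every other edge of which forms the matching.\<close>

lemma remove_matching:
  assumes fin: "finite V" and ev: "even (card V)" and n3: "3 \<le> card V"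
    and m: "\<And>p. p \<in> pairs V \<Longrightarrow> m p \<le> \<rho>" and \<rho>: "0 < \<rho>"
    and deg: "\<And>v. v \<in> V \<Longrightarrow> \<rho> * \<sigma> \<le> mdeg V m v" and \<sigma>: "card V \<le> 2 * \<sigma>"
  obtains M where "M \<subseteq> pairs V" "\<And>v. v \<in> V \<Longrightarrow> vdeg M v = 1" "\<And>p. p \<in> M \<Longrightarrow> 0 < m p"
proof -
  define E where "E = {p \<in> pairs V. 0 < m p}"
  have Ep: "E \<subseteq> pairs V" by (auto simp: E_def)
  have "card V \<le> 2 * vdeg E v" if v: "v \<in> V" for v
  proof -
    have "mdeg V m v \<le> mdeg V (\<lambda>p. \<rho> * of_bool (p \<in> E)) v"
      unfolding mdeg_def using m by (intro sum_mono) (auto simp: E_def)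
    also have "\<dots> = \<rho> * mdeg V (\<lambda>p. of_bool (p \<in> E)) v" by (simp add: mdeg_def sum_distrib_left)
    also have "\<dots> = \<rho> * vdeg E v" by (simp only: mdeg_of_bool[OF fin Ep])
    finally have "\<rho> * \<sigma> \<le> \<rho> * vdeg E v" using deg[OF v] by linarith
    then have "\<sigma> \<le> vdeg E v" using \<rho> by simp
    then show ?thesis using \<sigma> by linarith
  qed
  then obtain C where C: "ham V C" "C \<subseteq> E" using ham_dirac[OF fin n3 Ep] by blast
  then obtain M where "M \<subseteq> C" "\<forall>v\<in>V. vdeg M v = 1" using ham_facts(5)[OF C(1) fin ev] by metis
  then show ?thesis using that[of M] C(2) by (auto simp: E_def)
qed

lemma remove_matchings:
  assumes fin: "finite V" and ev: "even (card V)" and n3: "3 \<le> card V"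
    and m: "\<And>p. p \<in> pairs V \<Longrightarrow> m p \<le> \<rho>" and \<rho>: "0 < \<rho>"
    and deg: "\<And>v. v \<in> V \<Longrightarrow> mdeg V m v = \<rho> * \<sigma> + k" and \<sigma>: "card V \<le> 2 * \<sigma>"
  shows "\<exists>Ms m'. length Ms = k \<and> (\<forall>M\<in>set Ms. M \<subseteq> pairs V \<and> (\<forall>v\<in>V. vdeg M v = 1)) \<and>
    (\<forall>p\<in>pairs V. m p = cover Ms p + m' p) \<and> (\<forall>v\<in>V. mdeg V m' v = \<rho> * \<sigma>)"
  using m deg
proof (induction k arbitrary: m)
  case 0
  then show ?case by (intro exI[of _ "[]"] exI[of _ m]) auto
next
  case (Suc k)
  obtain M where M: "M \<subseteq> pairs V" "\<And>v. v \<in> V \<Longrightarrow> vdeg M v = 1" "\<And>p. p \<in> M \<Longrightarrow> 0 < m p"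
    by (rule remove_matching[OF fin ev n3 Suc.prems(1) \<rho> _ \<sigma>]) (use Suc.prems(2) in auto)
  define m1 where "m1 p = m p - of_bool (p \<in> M)" for p
  have m1: "m p = of_bool (p \<in> M) + m1 p" for p using M(3)[of p] by (auto simp: m1_def)
  have "m1 p \<le> \<rho>" if "p \<in> pairs V" for p using Suc.prems(1)[OF that] m1[of p] by linarith
  moreover have "mdeg V m1 v = \<rho> * \<sigma> + k" if "v \<in> V" for v
  proof -
    have "mdeg V m v = mdeg V (\<lambda>p. of_bool (p \<in> M) + m1 p) v" by (rule mdeg_cong) (rule m1)
    then show ?thesis using Suc.prems(2)[OF that] M(2)[OF that]
      by (simp add: mdeg_add mdeg_of_bool[OF fin M(1)])
  qed
  ultimately obtain Ms m' where "length Ms = k" "\<forall>M\<in>set Ms. M \<subseteq> pairs V \<and> (\<forall>v\<in>V. vdeg M v = 1)"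
    "\<forall>p\<in>pairs V. m1 p = cover Ms p + m' p" "\<forall>v\<in>V. mdeg V m' v = \<rho> * \<sigma>"
    using Suc.IH[of m1] by blast
  then show ?case using M m1 by (intro exI[of _ "M # Ms"] exI[of _ m']) auto
qed

text \<open>Rounding takes every entry that attains the bound, so each round lowers the bound on the
  entries by one and the line sums by \<open>\<sigma>\<close>.\<close>

lemma split_matrix:
  fixes a :: "'v \<Rightarrow> 'v \<Rightarrow> nat"
  assumes fin: "finite V"
    and "\<And>u v. u \<in> V \<Longrightarrow> v \<in> V \<Longrightarrow> a u v \<le> t"
    and "\<And>u. u \<in> V \<Longrightarrow> (\<Sum>v\<in>V. a u v) = t * \<sigma>" "\<And>u. u \<in> V \<Longrightarrow> (\<Sum>v\<in>V. a v u) = t * \<sigma>"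
  shows "\<exists>Xs. length Xs = t \<and>
    (\<forall>X\<in>set Xs. X \<subseteq> V \<times> V \<and> (\<forall>v\<in>V. card {u. (v, u) \<in> X} = \<sigma> \<and> card {u. (u, v) \<in> X} = \<sigma>)) \<and>
    (\<forall>u\<in>V. \<forall>v\<in>V. a u v = length (filter (\<lambda>X. (u, v) \<in> X) Xs))"
  using assms(2-)
proof (induction t arbitrary: a)
  case 0
  then show ?case by (intro exI[of _ "[]"]) auto
next
  case (Suc t)
  have dvd: "Suc t dvd (\<Sum>v\<in>V. a u v)" "Suc t dvd (\<Sum>v\<in>V. a v u)" if "u \<in> V" for u
    unfolding Suc.prems(2)[OF that] Suc.prems(3)[OF that] by (rule dvd_triv_left)+
  obtain X where X: "X \<subseteq> V \<times> V" "\<And>i j. (i, j) \<in> X \<Longrightarrow> 0 < a i j"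
    "\<And>i j. i \<in> V \<Longrightarrow> j \<in> V \<Longrightarrow> a i j = Suc t \<Longrightarrow> (i, j) \<in> X"
    "\<And>i. i \<in> V \<Longrightarrow> Suc t * card {j. (i, j) \<in> X} = (\<Sum>j\<in>V. a i j)"
    "\<And>j. j \<in> V \<Longrightarrow> Suc t * card {i. (i, j) \<in> X} = (\<Sum>i\<in>V. a i j)"
    using bipartite_rounding[OF fin fin zero_less_Suc Suc.prems(1) dvd empty_subsetI] by metis
  have card: "card {u. (v, u) \<in> X} = \<sigma>" "card {u. (u, v) \<in> X} = \<sigma>" if "v \<in> V" for v
    using X(4,5)[OF that] Suc.prems(2,3)[OF that] by (metis Suc_mult_cancel1)+
  define b where "b u v = a u v - of_bool ((u, v) \<in> X)" for u v
  have b: "a u v = of_bool ((u, v) \<in> X) + b u v" for u v using X(2)[of u v] by (auto simp: b_def)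
  have b_le: "b u v \<le> t" if "u \<in> V" "v \<in> V" for u v
    using Suc.prems(1)[OF that] X(3)[OF that] b[of u v] by (cases "a u v = Suc t") auto
  have b_sum: "(\<Sum>v\<in>V. b u v) = t * \<sigma>" "(\<Sum>v\<in>V. b v u) = t * \<sigma>" if "u \<in> V" for u
  proof -
    have "V \<inter> {v. (u, v) \<in> X} = {v. (u, v) \<in> X}" "V \<inter> {v. (v, u) \<in> X} = {v. (v, u) \<in> X}"
      using X(1) by auto
    then have "(\<Sum>v\<in>V. of_bool ((u, v) \<in> X)) = \<sigma>" "(\<Sum>v\<in>V. of_bool ((v, u) \<in> X)) = \<sigma>"
      using fin card[OF that] by (simp_all add: of_bool_def sum.If_cases)
    moreover have "(\<Sum>v\<in>V. of_bool ((u, v) \<in> X) + b u v) = Suc t * \<sigma>"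
      "(\<Sum>v\<in>V. of_bool ((v, u) \<in> X) + b v u) = Suc t * \<sigma>"
      using Suc.prems(2,3)[OF that] by (simp_all only: b[symmetric])
    ultimately show "(\<Sum>v\<in>V. b u v) = t * \<sigma>" "(\<Sum>v\<in>V. b v u) = t * \<sigma>"
      by (simp_all add: sum.distrib)
  qed
  have "\<exists>Xs. length Xs = t \<and>
    (\<forall>X\<in>set Xs. X \<subseteq> V \<times> V \<and> (\<forall>v\<in>V. card {u. (v, u) \<in> X} = \<sigma> \<and> card {u. (u, v) \<in> X} = \<sigma>)) \<and>
    (\<forall>u\<in>V. \<forall>v\<in>V. b u v = length (filter (\<lambda>X. (u, v) \<in> X) Xs))"
    by (rule Suc.IH[OF b_le b_sum])
  then obtain Xs where "length Xs = t"
    "\<forall>X\<in>set Xs. X \<subseteq> V \<times> V \<and> (\<forall>v\<in>V. card {u. (v, u) \<in> X} = \<sigma> \<and> card {u. (u, v) \<in> X} = \<sigma>)"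
    "\<forall>u\<in>V. \<forall>v\<in>V. b u v = length (filter (\<lambda>X. (u, v) \<in> X) Xs)"
    by (elim exE conjE) (rule that)
  then show ?case using X(1) card b by (intro exI[of _ "X # Xs"]) auto
qed

text \<open>All three parts of each digraph are kept, so every multiplicity is accounted for exactly
  and no pairs have to be avoided: \<open>Z\<close> is empty.\<close>

lemma split_all:
  assumes fin: "finite V" and ev: "even (card V)" and n3: "3 \<le> card V" and \<sigma>: "card V + 30 \<le> 2 * \<sigma>"
    and "\<forall>X\<in>set Xs. X \<subseteq> V \<times> V \<and> (\<forall>v. (v, v) \<notin> X) \<and>
      (\<forall>v\<in>V. card {u. (v, u) \<in> X} = \<sigma> \<and> card {u. (u, v) \<in> X} = \<sigma>)"
  shows "\<exists>Cs Ts. length Cs = length Xs \<and> length Ts = 2 * length Xs \<and> (\<forall>C\<in>set Cs. ham V C) \<and>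
    (\<forall>T\<in>set Ts. T \<subseteq> pairs V \<and> (\<forall>v\<in>V. vdeg T v = \<sigma> - 1)) \<and>
    (\<forall>u v. u \<noteq> v \<longrightarrow> cover Cs {u, v} + cover Ts {u, v} =
      length (filter (\<lambda>X. (u, v) \<in> X) Xs) + length (filter (\<lambda>X. (v, u) \<in> X) Xs))"
  using assms(5)
proof (induction Xs)
  case Nil
  then show ?case by (intro exI[of _ "[]"]) auto
next
  case (Cons X Xs)
  then obtain Cs Ts where IH: "length Cs = length Xs" "length Ts = 2 * length Xs" "\<forall>C\<in>set Cs. ham V C"
    "\<forall>T\<in>set Ts. T \<subseteq> pairs V \<and> (\<forall>v\<in>V. vdeg T v = \<sigma> - 1)"
    "\<forall>u v. u \<noteq> v \<longrightarrow> cover Cs {u, v} + cover Ts {u, v} =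
      length (filter (\<lambda>X. (u, v) \<in> X) Xs) + length (filter (\<lambda>X. (v, u) \<in> X) Xs)"
    by auto
  have X: "X \<subseteq> V \<times> V" "\<And>v. (v, v) \<notin> X" "\<And>v. v \<in> V \<Longrightarrow> card {u. (v, u) \<in> X} = \<sigma>"
    "\<And>v. v \<in> V \<Longrightarrow> card {u. (u, v) \<in> X} = \<sigma>" using Cons.prems by auto
  obtain H A B where HAB: "ham V H" "A \<subseteq> pairs V" "B \<subseteq> pairs V"
    "\<And>v. v \<in> V \<Longrightarrow> vdeg A v = \<sigma> - 1" "\<And>v. v \<in> V \<Longrightarrow> vdeg B v = \<sigma> - 1"
    "\<And>u v. u \<noteq> v \<Longrightarrow> (of_bool ({u, v} \<in> H) + of_bool ({u, v} \<in> A) + of_bool ({u, v} \<in> B) :: nat)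
      = of_bool ((u, v) \<in> X) + of_bool ((v, u) \<in> X)"
    by (rule hamilton_split[OF fin ev n3 X \<sigma>, of "{}"]) auto
  show ?case
  proof (intro exI conjI allI impI)
    fix u v :: 'a assume "u \<noteq> v"
    show "cover (H # Cs) {u, v} + cover (A # B # Ts) {u, v} =
      length (filter (\<lambda>X. (u, v) \<in> X) (X # Xs)) + length (filter (\<lambda>X. (v, u) \<in> X) (X # Xs))"
      using IH(5)[rule_format, OF \<open>u \<noteq> v\<close>] HAB(6)[OF \<open>u \<noteq> v\<close>]
      unfolding cover_simps length_filter_Cons by linarith
  qed (use IH HAB in auto)
qed

text \<open>Each multiplicity is divided evenly between the two directions. The pairs of odd
  multiplicity form a graph with even degrees, and their spare units follow a balanced orientation
  of it, so all line sums become exactly \<open>t * \<sigma>\<close>.\<close>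

theorem even_split:
  assumes fin: "finite V" and ev: "even (card V)" and n3: "3 \<le> card V" and \<sigma>: "card V + 30 \<le> 2 * \<sigma>"
    and m: "\<And>p. p \<in> pairs V \<Longrightarrow> m p \<le> 2 * t"
    and deg: "\<And>v. v \<in> V \<Longrightarrow> mdeg V m v = 2 * t * \<sigma>"
  shows "\<exists>Cs Ts. length Cs = t \<and> length Ts = 2 * t \<and> (\<forall>C\<in>set Cs. ham V C) \<and>
    (\<forall>T\<in>set Ts. T \<subseteq> pairs V \<and> (\<forall>v\<in>V. vdeg T v = \<sigma> - 1)) \<and>
    (\<forall>p\<in>pairs V. m p = cover Cs p + cover Ts p)"
proof -
  define E where "E = {p \<in> pairs V. odd (m p)}"
  have Ep: "E \<subseteq> pairs V" by (auto simp: E_def)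
  have "even (vdeg E v)" for v
  proof (cases "v \<in> V")
    case True
    have "mdeg V m v = mdeg V (\<lambda>p. of_bool (p \<in> E) + 2 * (m p div 2)) v"
      by (rule mdeg_cong) (auto simp: E_def)
    also have "\<dots> = vdeg E v + 2 * mdeg V (\<lambda>p. m p div 2) v"
      by (simp add: mdeg_add mdeg_of_bool[OF fin Ep]) (simp add: mdeg_def sum_distrib_left)
    finally have "vdeg E v + 2 * mdeg V (\<lambda>p. m p div 2) v = 2 * (t * \<sigma>)"
      using deg[OF True] by simp
    then show ?thesis by presburger
  qed (use vdeg_outside[OF Ep] in simp)
  then obtain Ar where Ar: "\<And>a b. {a, b} \<in> E \<longleftrightarrow> (a, b) \<in> Ar \<or> (b, a) \<in> Ar"
      "\<And>a b. (a, b) \<in> Ar \<Longrightarrow> (b, a) \<notin> Ar"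
      "\<And>w. (\<Sum>u\<in>V - {w}. of_bool ((w, u) \<in> Ar) :: nat) = (\<Sum>u\<in>V - {w}. of_bool ((u, w) \<in> Ar))"
    using balanced_orientation_sums[OF fin Ep] by metis
  define a where "a u v = (if u = v then 0 else m {u, v} div 2 + of_bool ((u, v) \<in> Ar))" for u v
  have odd: "odd (m {u, v}) \<longleftrightarrow> (u, v) \<in> Ar \<or> (v, u) \<in> Ar" if "u \<in> V" "v \<in> V" "u \<noteq> v" for u v
    using Ar(1)[of u v] that by (simp add: E_def)
  have anti: "(u, v) \<notin> Ar \<or> (v, u) \<notin> Ar" for u v using Ar(2) by blast
  have mm: "m {v, u} = m {u, v}" for u v by (simp add: insert_commute)
  have key: "(k div 2 + of_bool P) + (k div 2 + of_bool Q) = k \<and>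
      2 * (k div 2 + of_bool P) + of_bool Q = k + of_bool P"
    if "odd k \<longleftrightarrow> P \<or> Q" "\<not> P \<or> \<not> Q" for k :: nat and P Q
    using that by (cases P; cases Q; simp; presburger)
  have a_half: "a u v = m {u, v} div 2 + of_bool ((u, v) \<in> Ar)"
    "a v u = m {u, v} div 2 + of_bool ((v, u) \<in> Ar)" if "u \<noteq> v" for u v
    using that mm[of u v] by (auto simp: a_def)
  have aa: "a u v + a v u = m {u, v}" and
    a2: "2 * a u v + of_bool ((v, u) \<in> Ar) = m {u, v} + of_bool ((u, v) \<in> Ar)"
    if "u \<in> V" "v \<in> V" "u \<noteq> v" for u v
    unfolding a_half[OF that(3)] using key[OF odd[OF that] anti] by blast+
  have a2': "2 * a v u + of_bool ((u, v) \<in> Ar) = m {u, v} + of_bool ((v, u) \<in> Ar)"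
    if "u \<in> V" "v \<in> V" "u \<noteq> v" for u v
    using a2[of v u] that mm[of u v] by simp
  have sums: "(\<Sum>v\<in>V. a u v) = t * \<sigma>" "(\<Sum>v\<in>V. a v u) = t * \<sigma>" if u: "u \<in> V" for u
  proof -
    have md: "(\<Sum>v\<in>V - {u}. m {u, v}) = 2 * t * \<sigma>" using mdeg_nb[OF u] deg[OF u] by simp
    have "(\<Sum>v\<in>V. a u v) = (\<Sum>v\<in>V - {u}. a u v)"
      using u fin by (subst sum.remove[of _ u]) (auto simp: a_def)
    moreover have "(\<Sum>v\<in>V - {u}. 2 * a u v + of_bool ((v, u) \<in> Ar)) =
        (\<Sum>v\<in>V - {u}. m {u, v} + of_bool ((u, v) \<in> Ar))"
      by (intro sum.cong refl a2) (use u in auto)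
    ultimately show "(\<Sum>v\<in>V. a u v) = t * \<sigma>"
      using Ar(3)[of u] md by (simp add: sum.distrib flip: sum_distrib_left)
    have "(\<Sum>v\<in>V. a v u) = (\<Sum>v\<in>V - {u}. a v u)"
      using u fin by (subst sum.remove[of _ u]) (auto simp: a_def)
    moreover have "(\<Sum>v\<in>V - {u}. 2 * a v u + of_bool ((u, v) \<in> Ar)) =
        (\<Sum>v\<in>V - {u}. m {u, v} + of_bool ((v, u) \<in> Ar))"
      by (intro sum.cong refl a2') (use u in auto)
    ultimately show "(\<Sum>v\<in>V. a v u) = t * \<sigma>"
      using Ar(3)[of u] md by (simp add: sum.distrib flip: sum_distrib_left)
  qed
  \<comment> \<open>An odd multiplicity is at most \<open>2 * t - 1\<close>, so its larger half does
    not exceed \<open>t\<close>.\<close>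
  have a_le: "a u v \<le> t" if uv: "u \<in> V" "v \<in> V" for u v
  proof (cases "u = v")
    case False
    then have "m {u, v} \<le> 2 * t" using m uv by simp
    moreover have "(u, v) \<in> Ar \<Longrightarrow> odd (m {u, v})" using odd[OF uv False] by simp
    ultimately show ?thesis unfolding a_half[OF False]
      by (cases "(u, v) \<in> Ar"; simp; presburger)
  qed (simp add: a_def)
  have "\<exists>Xs. length Xs = t \<and>
    (\<forall>X\<in>set Xs. X \<subseteq> V \<times> V \<and> (\<forall>v\<in>V. card {u. (v, u) \<in> X} = \<sigma> \<and> card {u. (u, v) \<in> X} = \<sigma>)) \<and>
    (\<forall>u\<in>V. \<forall>v\<in>V. a u v = length (filter (\<lambda>X. (u, v) \<in> X) Xs))"
    by (rule split_matrix[OF fin a_le sums])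
  then obtain Xs where Xs: "length Xs = t"
    "\<forall>X\<in>set Xs. X \<subseteq> V \<times> V \<and> (\<forall>v\<in>V. card {u. (v, u) \<in> X} = \<sigma> \<and> card {u. (u, v) \<in> X} = \<sigma>)"
    "\<forall>u\<in>V. \<forall>v\<in>V. a u v = length (filter (\<lambda>X. (u, v) \<in> X) Xs)"
    by (elim exE conjE) (rule that)
  have irr: "(v, v) \<notin> X" if "X \<in> set Xs" for X v
  proof
    assume vX: "(v, v) \<in> X"
    then have "v \<in> V" using Xs(2) that by blast
    then have "a v v = length (filter (\<lambda>X. (v, v) \<in> X) Xs)" using Xs(3) by blast
    then have "filter (\<lambda>X. (v, v) \<in> X) Xs = []" by (simp add: a_def)
    then show False using vX that by (simp add: filter_empty_conv)
  qed
  have "\<forall>X\<in>set Xs. X \<subseteq> V \<times> V \<and> (\<forall>v. (v, v) \<notin> X) \<and>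
      (\<forall>v\<in>V. card {u. (v, u) \<in> X} = \<sigma> \<and> card {u. (u, v) \<in> X} = \<sigma>)"
    using Xs(2) irr by (intro ballI conjI) auto
  from split_all[OF fin ev n3 \<sigma> this]
  obtain Cs Ts where CT: "length Cs = length Xs" "length Ts = 2 * length Xs" "\<forall>C\<in>set Cs. ham V C"
    "\<forall>T\<in>set Ts. T \<subseteq> pairs V \<and> (\<forall>v\<in>V. vdeg T v = \<sigma> - 1)"
    "\<forall>u v. u \<noteq> v \<longrightarrow> cover Cs {u, v} + cover Ts {u, v} =
      length (filter (\<lambda>X. (u, v) \<in> X) Xs) + length (filter (\<lambda>X. (v, u) \<in> X) Xs)"
    by (elim exE conjE) (rule that)
  have "m p = cover Cs p + cover Ts p" if p: "p \<in> pairs V" for p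
  proof -
    obtain u v where uv: "p = {u, v}" "u \<in> V" "v \<in> V" "u \<noteq> v" using p by (rule pairsE)
    then show ?thesis using CT(5)[rule_format, of u v] Xs(3) aa[of u v] by simp
  qed
  then show ?thesis using CT Xs(1) by (intro exI[of _ Cs] exI[of _ Ts]) auto
qed

lemma multiplicity_decomposition:
  assumes fin: "finite V" and ev: "even (card V)" and n3: "3 \<le> card V"
    and m: "\<forall>p\<in>pairs V. m p \<le> r" and r: "odd r" "3 \<le> r"
    and deg: "\<forall>v\<in>V. mdeg V m v = r * s" and s: "card V + 32 \<le> 2 * s"
  shows "\<exists>Ms Cs S Ts. length Ms = r - 2 \<and> (\<forall>M\<in>set Ms. M \<subseteq> pairs V \<and> (\<forall>v\<in>V. vdeg M v = 1)) \<and>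
    length Cs = (r + 1) div 2 \<and> (\<forall>C\<in>set Cs. ham V C) \<and>
    S \<subseteq> pairs V \<and> (\<forall>v\<in>V. vdeg S v = s - 1) \<and>
    length Ts = r - 1 \<and> (\<forall>T\<in>set Ts. T \<subseteq> pairs V \<and> (\<forall>v\<in>V. vdeg T v = s - 2)) \<and>
    (\<forall>p\<in>pairs V. m p = cover (Ms @ Cs @ [S] @ Ts) p)"
proof -
  note m = bspec[OF m] and deg = bspec[OF deg]
  obtain t where t: "r = 2 * t + 1" using r(1) by (rule oddE)
  then have t0: "0 < t" using r(2) by simp
  obtain \<sigma> where \<sigma>: "s = Suc \<sigma>" using s by (cases s) auto
  have s30: "card V + 30 \<le> 2 * s" using s by simp
  obtain H A where HA: "ham V H" "A \<subseteq> pairs V" "\<And>v. v \<in> V \<Longrightarrow> vdeg A v = s - 1"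
    "\<And>p. p \<in> pairs V \<Longrightarrow> of_bool (p \<in> H) + of_bool (p \<in> A) \<le> m p"
    "\<And>p. p \<in> pairs V \<Longrightarrow> m p \<le> r - 1 + of_bool (p \<in> H) + of_bool (p \<in> A)"
    by (rule extract_full[OF fin ev n3 m r(2) deg s30]) (assumption | blast)+
  define m1 where "m1 p = m p - (of_bool (p \<in> H) + of_bool (p \<in> A))" for p
  have m1: "m p = of_bool (p \<in> H) + of_bool (p \<in> A) + m1 p" if "p \<in> pairs V" for p
    using HA(4)[OF that] unfolding m1_def by simp
  have m1_le: "m1 p \<le> 2 * t" if "p \<in> pairs V" for p
    using HA(5)[OF that] m1[OF that] t by linarith
  have Hp: "H \<subseteq> pairs V" using ham_facts(1)[OF HA(1) fin] .
  \<comment> \<open>\<open>H\<close> and \<open>A\<close> take degree \<open>2 + (s - 1)\<close>,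
    and \<open>r * s - (s + 1) = (r - 1) * (s - 1) + (r - 2)\<close>: the excess over a multiple of
    \<open>r - 1\<close> is the number of matchings to remove.\<close>
  have "mdeg V m1 v = 2 * t * \<sigma> + (2 * t - 1)" if v: "v \<in> V" for v
  proof -
    have "mdeg V m v = mdeg V (\<lambda>p. of_bool (p \<in> H) + of_bool (p \<in> A) + m1 p) v"
      by (rule mdeg_cong) (rule m1)
    also have "\<dots> = 2 + \<sigma> + mdeg V m1 v"
      using HA(3)[OF v] ham_facts(3)[OF HA(1) fin v] \<sigma>
      by (simp add: mdeg_add mdeg_of_bool[OF fin Hp] mdeg_of_bool[OF fin HA(2)])
    finally show ?thesis using deg[OF v] t t0 \<sigma> by (simp add: algebra_simps)
  qed
  then obtain Ms m' where M: "length Ms = 2 * t - 1" "\<forall>M\<in>set Ms. M \<subseteq> pairs V \<and> (\<forall>v\<in>V. vdeg M v = 1)"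
    "\<forall>p\<in>pairs V. m1 p = cover Ms p + m' p" "\<forall>v\<in>V. mdeg V m' v = 2 * t * \<sigma>"
    using remove_matchings[OF fin ev n3, of m1 "2 * t" \<sigma> "2 * t - 1"] m1_le t0 s \<sigma> by auto
  have "m' p \<le> 2 * t" if "p \<in> pairs V" for p using m1_le[OF that] M(3) that by fastforce
  then obtain Cs Ts where CT: "length Cs = t" "length Ts = 2 * t" "\<forall>C\<in>set Cs. ham V C"
    "\<forall>T\<in>set Ts. T \<subseteq> pairs V \<and> (\<forall>v\<in>V. vdeg T v = \<sigma> - 1)" "\<forall>p\<in>pairs V. m' p = cover Cs p + cover Ts p"
    using even_split[OF fin ev n3, of \<sigma> m' t] M(4) s \<sigma> by auto
  show ?thesis
  proof (intro exI conjI ballI)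
    show "m p = cover (Ms @ (H # Cs) @ [A] @ Ts) p" if "p \<in> pairs V" for p
      using m1[OF that] M(3) CT(5) that by simp
  qed (use M CT HA t \<sigma> in auto)
qed

subsection \<open>Subgraphs\<close>

text \<open>Removing \<open>r\<close> matchings first lowers the degree from \<open>r * s\<close> to
  \<open>r * (s - 1)\<close> without raising any multiplicity, and the previous decomposition
  applies with \<open>s - 1\<close>; the matchings number \<open>r + (r - 2)\<close>.\<close>

lemma multiplicity_decomposition_more_matchings:
  assumes fin: "finite V" and ev: "even (card V)" and n3: "3 \<le> card V"
    and m: "\<forall>p\<in>pairs V. m p \<le> r" and r: "odd r" "3 \<le> r"
    and deg: "\<forall>v\<in>V. mdeg V m v = r * s" and s: "card V + 34 \<le> 2 * s"
  shows "\<exists>Ms Cs S Ts. length Ms = 2 * r - 2 \<and> (\<forall>M\<in>set Ms. M \<subseteq> pairs V \<and> (\<forall>v\<in>V. vdeg M v = 1)) \<and>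
    length Cs = (r + 1) div 2 \<and> (\<forall>C\<in>set Cs. ham V C) \<and>
    S \<subseteq> pairs V \<and> (\<forall>v\<in>V. vdeg S v = s - 2) \<and>
    length Ts = r - 1 \<and> (\<forall>T\<in>set Ts. T \<subseteq> pairs V \<and> (\<forall>v\<in>V. vdeg T v = s - 3)) \<and>
    (\<forall>p\<in>pairs V. m p = cover (Ms @ Cs @ [S] @ Ts) p)"
proof -
  note m = bspec[OF m] and deg = bspec[OF deg]
  obtain \<sigma> where \<sigma>: "s = Suc \<sigma>" using s by (cases s) auto
  have r0: "0 < r" using r by simp
  have "mdeg V m v = r * \<sigma> + r" if "v \<in> V" for v using deg[OF that] \<sigma> by simp
  then have "\<exists>Ms m'. length Ms = r \<and> (\<forall>M\<in>set Ms. M \<subseteq> pairs V \<and> (\<forall>v\<in>V. vdeg M v = 1)) \<and>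
    (\<forall>p\<in>pairs V. m p = cover Ms p + m' p) \<and> (\<forall>v\<in>V. mdeg V m' v = r * \<sigma>)"
    using s \<sigma> by (intro remove_matchings[OF fin ev n3 m r0]) auto
  then obtain Ns m' where N: "length Ns = r" "\<forall>M\<in>set Ns. M \<subseteq> pairs V \<and> (\<forall>v\<in>V. vdeg M v = 1)"
    "\<forall>p\<in>pairs V. m p = cover Ns p + m' p" "\<forall>v\<in>V. mdeg V m' v = r * \<sigma>"
    by (elim exE conjE) (rule that)
  have m': "\<forall>p\<in>pairs V. m' p \<le> r" using m N(3) by fastforce
  have s': "card V + 32 \<le> 2 * \<sigma>" using s \<sigma> by simp
  from multiplicity_decomposition[OF fin ev n3 m' r N(4) s']
  obtain Ms Cs S Ts where *: "length Ms = r - 2" "\<forall>M\<in>set Ms. M \<subseteq> pairs V \<and> (\<forall>v\<in>V. vdeg M v = 1)"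
    "length Cs = (r + 1) div 2" "\<forall>C\<in>set Cs. ham V C" "S \<subseteq> pairs V" "\<forall>v\<in>V. vdeg S v = \<sigma> - 1"
    "length Ts = r - 1" "\<forall>T\<in>set Ts. T \<subseteq> pairs V \<and> (\<forall>v\<in>V. vdeg T v = \<sigma> - 2)"
    "\<forall>p\<in>pairs V. m' p = cover (Ms @ Cs @ [S] @ Ts) p"
    by (elim exE conjE) (rule that)
  show ?thesis
  proof (intro exI conjI)
    show "length (Ns @ Ms) = 2 * r - 2" using N(1) *(1) r by simp
    show "\<forall>M\<in>set (Ns @ Ms). M \<subseteq> pairs V \<and> (\<forall>v\<in>V. vdeg M v = 1)"
      using N(2) *(2) by (simp add: ball_Un)
    show "\<forall>v\<in>V. vdeg S v = s - 2" using *(6) \<sigma> by simp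
    show "\<forall>T\<in>set Ts. T \<subseteq> pairs V \<and> (\<forall>v\<in>V. vdeg T v = s - 3)" using *(8) \<sigma> by simp
    show "\<forall>p\<in>pairs V. m p = cover ((Ns @ Ms) @ Cs @ [S] @ Ts) p" using N(3) *(9) by simp
  qed (fact *)+
qed

section \<open>From pair multiplicities back to the edges of \<open>G\<close>\<close>

text \<open>For each pair of the first graph one edge with these ends is picked and removed; every
  fibre then shrinks by exactly what that graph contributed to \<open>cover\<close>.\<close>

lemma realise_cover:
  assumes "finite E" "\<And>p. card {e \<in> E. f e = p} = cover Ps p"
  shows "\<exists>Es. list_all2 (bij_betw f) Es Ps \<and> \<Union>(set Es) = E \<and>
    (\<forall>i<length Es. \<forall>j<length Es. i \<noteq> j \<longrightarrow> Es ! i \<inter> Es ! j = {})"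
  using assms
proof (induction Ps arbitrary: E)
  case Nil
  have "E = {}"
  proof (rule ccontr)
    assume "E \<noteq> {}"
    then obtain e where "e \<in> E" by blast
    then have "card {e' \<in> E. f e' = f e} \<noteq> 0" using Nil(1) by auto
    then show False using Nil(2)[of "f e"] by simp
  qed
  then show ?case by (intro exI[of _ "[]"]) auto
next
  case (Cons P Ps)
  have "\<exists>e\<in>E. f e = p" if "p \<in> P" for p
  proof (rule ccontr)
    assume "\<not> ?thesis"
    then have "{e \<in> E. f e = p} = {}" by blast
    then have "card {e \<in> E. f e = p} = 0" by (simp only: card.empty)
    then show False using Cons.prems(2)[of p] that by simp
  qed
  then obtain c where c: "\<And>p. p \<in> P \<Longrightarrow> c p \<in> E \<and> f (c p) = p" by metis
  define F where "F = E - c ` P"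
  have bij: "bij_betw f (c ` P) P"
    using c by (auto simp: bij_betw_def inj_on_def image_iff)
  have "card {e \<in> F. f e = p} = cover Ps p" for p
  proof -
    have fib: "card {e \<in> E. f e = p} = of_bool (p \<in> P) + cover Ps p"
      using Cons.prems(2)[of p] by simp
    show ?thesis
    proof (cases "p \<in> P")
      case True
      then have "{e \<in> F. f e = p} = {e \<in> E. f e = p} - {c p}"
        using c by (auto simp: F_def)
      moreover have "c p \<in> {e \<in> E. f e = p}" using c[OF True] by simp
      ultimately show ?thesis using fib True Cons.prems(1) by simp
    next
      case False
      then have "{e \<in> F. f e = p} = {e \<in> E. f e = p}" using c by (auto simp: F_def)
      then show ?thesis using fib False by simp
    qed
  qed
  then obtain Es where Es: "list_all2 (bij_betw f) Es Ps" "\<Union>(set Es) = F"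
    "\<forall>i<length Es. \<forall>j<length Es. i \<noteq> j \<longrightarrow> Es ! i \<inter> Es ! j = {}"
    using Cons.IH[of F] Cons.prems(1) by (auto simp: F_def)
  have dis: "c ` P \<inter> Es ! j = {}" if "j < length Es" for j
  proof -
    have "Es ! j \<subseteq> F" using Es(2) that nth_mem by blast
    then show ?thesis by (auto simp: F_def)
  qed
  show ?case
  proof (intro exI conjI allI impI)
    show "list_all2 (bij_betw f) (c ` P # Es) (P # Ps)" using bij Es(1) by simp
    show "\<Union>(set (c ` P # Es)) = E" using Es(2) c by (auto simp: F_def)
    fix i j assume "i < length (c ` P # Es)" "j < length (c ` P # Es)" "i \<noteq> j"
    then show "(c ` P # Es) ! i \<inter> (c ` P # Es) ! j = {}"
      using Es(3) dis by (cases i; cases j) (auto simp: Int_commute)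
  qed
qed

context multigraph
begin

definition pair_mult :: "'v set \<Rightarrow> nat" where
  "pair_mult p = card {e \<in> edges G. ends G e = p}"

text \<open>Changing only the edge set makes \<open>H\<close> spanning, and bijectivity makes it
  simple; its degrees can be read off \<open>P\<close>.\<close>

definition realises :: "('v, 'e) pre_multigraph \<Rightarrow> 'v set set \<Rightarrow> bool" where
  "realises H P \<longleftrightarrow> H = G\<lparr>edges := edges H\<rparr> \<and> edges H \<subseteq> edges G \<and> bij_betw (ends G) (edges H) P"

lemma ends_in_pairs: "e \<in> edges G \<Longrightarrow> ends G e \<in> pairs (verts G)"
  using ends_subset card_ends by (auto simp: pairs_def)

lemma realises_simps:
  assumes "realises H P"
  shows "verts H = verts G" "ends H = ends G" "edges H \<subseteq> edges G"
    "bij_betw (ends G) (edges H) P"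
proof -
  have H: "H = G\<lparr>edges := edges H\<rparr>" using assms by (simp add: realises_def)
  show "verts H = verts G" by (subst H) simp
  show "ends H = ends G" by (subst H) simp
qed (use assms in \<open>simp_all add: realises_def\<close>)

lemma realises_spanning:
  assumes "realises H P"
  shows "spanning_subgraph H G"
proof -
  note H = realises_simps[OF assms]
  have "multigraph H"
    using H finite_verts finite_subset[OF H(3) finite_edges] ends_subset card_ends
    by unfold_locales auto
  then show ?thesis using H by (auto simp: spanning_subgraph_def subgraph_def)
qed

lemma realises_degree:
  assumes "realises H P"
  shows "degree H v = vdeg P v"
proof -
  note H = realises_simps[OF assms]
  have img: "ends G ` {e \<in> edges H. v \<in> ends H e} = {p \<in> P. v \<in> p}"
    using H(2,4) by (auto simp: bij_betw_def)
  have "inj_on (ends G) {e \<in> edges H. v \<in> ends H e}"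
    using H(4) by (auto simp: bij_betw_def intro: inj_on_subset)
  from card_image[OF this] show ?thesis unfolding degree_def vdeg_def img by simp
qed

lemma realises_simple: "realises H P \<Longrightarrow> simple H"
  using realises_simps(2,4)[of H P] by (auto simp: simple_def bij_betw_def)

lemma realises_regular:
  assumes "realises H P" "\<forall>v\<in>verts G. vdeg P v = d"
  shows "regular d H"
  using assms realises_degree[OF assms(1)] realises_simps(1)[OF assms(1)]
  by (simp add: regular_def)

lemma realises_matching:
  assumes H: "realises H P" and P: "\<forall>v\<in>verts G. vdeg P v = 1"
  shows "perfect_matching H G"
proof -
  note s = realises_simps[OF H]
  have one: "card {e \<in> edges H. v \<in> ends H e} = 1" if "v \<in> verts G" for v
    using realises_degree[OF H, of v] P that by (simp add: degree_def)
  show ?thesis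
    unfolding perfect_matching_def
  proof (intro conjI ballI impI)
    show "spanning_subgraph H G" using H by (rule realises_spanning)
    fix e f assume ef: "e \<in> edges H" "f \<in> edges H" "e \<noteq> f"
    show "ends H e \<inter> ends H f = {}"
    proof (rule ccontr)
      assume "ends H e \<inter> ends H f \<noteq> {}"
      then obtain v where v: "v \<in> ends H e" "v \<in> ends H f" by blast
      then have "v \<in> verts G" using ends_subset[of e] ef s by auto
      then obtain x where x: "{e \<in> edges H. v \<in> ends H e} = {x}" using one card_1_singletonE by metis
      have "e \<in> {e \<in> edges H. v \<in> ends H e}" "f \<in> {e \<in> edges H. v \<in> ends H e}" using ef v by auto
      then show False using ef(3) unfolding x by simp
    qed
  next
    show "(\<Union>e\<in>edges H. ends H e) = verts G"
    proof
      show "(\<Union>e\<in>edges H. ends H e) \<subseteq> verts G" using ends_subset s by auto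
      show "verts G \<subseteq> (\<Union>e\<in>edges H. ends H e)"
      proof
        fix v assume "v \<in> verts G"
        then obtain x where x: "{e \<in> edges H. v \<in> ends H e} = {x}" using one card_1_singletonE by metis
        have "x \<in> {e \<in> edges H. v \<in> ends H e}" unfolding x by simp
        then show "v \<in> (\<Union>e\<in>edges H. ends H e)" by blast
      qed
    qed
  qed
qed

text \<open>The inverse of \<open>ends G\<close> on the edges of \<open>H\<close> turns the cyclic
  list of pairs into the required list of edges.\<close>

lemma realises_hamilton:
  assumes H: "realises H P" and P: "ham (verts G) P"
  shows "hamilton_cycle H G"
proof -
  note s = realises_simps[OF H]
  obtain vs where vs: "distinct vs" "set vs = verts G" "3 \<le> length vs" "P = cycle_edges vs"
    using P by (auto simp: ham_def)
  let ?n = "length vs"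
  let ?p = "\<lambda>i. {vs ! i, vs ! (Suc i mod ?n)}"
  define g where "g = inv_into (edges H) (ends G)"
  have g: "bij_betw g P (edges H)" "\<And>p. p \<in> P \<Longrightarrow> ends G (g p) = p"
    unfolding g_def using bij_betw_inv_into[OF s(4)] bij_betw_inv_into_right[OF s(4)] by auto
  have P': "P = ?p ` {..<?n}" using vs by (simp add: cycle_edges_def)
  define es where "es = map (\<lambda>i. g (?p i)) [0..<?n]"
  have "inj_on (\<lambda>i. g (?p i)) {..<?n}"
    using comp_inj_on[OF inj_on_cycle_edges[OF vs(1,3)], of g] g(1) P'
    by (simp add: bij_betw_def comp_def)
  then have "distinct es"
    unfolding es_def by (simp add: distinct_map atLeast0LessThan)
  moreover have "set es = edges H"
  proof -
    have "set es = g ` P" unfolding P' es_def by (auto simp: image_image atLeast0LessThan)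
    then show ?thesis using g(1) by (simp add: bij_betw_def)
  qed
  moreover have "ends H (es ! i) = ?p i" if "i < ?n" for i
    using that g(2)[of "?p i"] s(2) P' by (simp add: es_def)
  ultimately have "cycle H"
    unfolding cycle_def using vs s(1)
    by (intro exI[of _ vs] exI[of _ es]) (auto simp: es_def)
  then show ?thesis using realises_spanning[OF H] by (simp add: hamilton_cycle_def)
qed

lemma realise_decomposition:
  assumes P: "\<And>P. P \<in> set Ps \<Longrightarrow> P \<subseteq> pairs (verts G)"
    and m: "\<And>p. p \<in> pairs (verts G) \<Longrightarrow> pair_mult p = cover Ps p"
  obtains Hs where "list_all2 realises Hs Ps" "decomposition G Hs"
proof -
  have "card {e \<in> edges G. ends G e = p} = cover Ps p" for p
  proof (cases "p \<in> pairs (verts G)")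
    case True
    then show ?thesis using m by (simp add: pair_mult_def)
  next
    case False
    \<comment> \<open>Off \<open>pairs (verts G)\<close> both sides vanish, so the identity holds
      for all \<open>p\<close>, as the realisation requires.\<close>
    then have "{e \<in> edges G. ends G e = p} = {}" "filter (\<lambda>P. p \<in> P) Ps = []"
      using ends_in_pairs P by (auto simp: filter_empty_conv)
    then show ?thesis by (simp only: cover_def list.size card.empty)
  qed
  then obtain Es where Es: "list_all2 (bij_betw (ends G)) Es Ps" "\<Union>(set Es) = edges G"
    "\<forall>i<length Es. \<forall>j<length Es. i \<noteq> j \<longrightarrow> Es ! i \<inter> Es ! j = {}"
    using realise_cover[OF finite_edges] by blast
  define Hs where "Hs = map (\<lambda>E. G\<lparr>edges := E\<rparr>) Es"
  have sub: "E \<subseteq> edges G" if "E \<in> set Es" for E using Es(2) that by blast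
  have "list_all2 realises Hs Ps"
    using Es(1) sub unfolding Hs_def list_all2_map1
    by (auto simp: list_all2_conv_all_nth realises_def)
  moreover have "decomposition G Hs"
    unfolding decomposition_def
  proof (intro conjI ballI allI impI)
    fix H assume "H \<in> set Hs"
    then obtain P where "realises H P"
      using \<open>list_all2 realises Hs Ps\<close> by (metis in_set_conv_nth list_all2_conv_all_nth)
    then show "subgraph H G" using realises_spanning by (auto simp: spanning_subgraph_def)
  next
    fix i j assume "i < length Hs" "j < length Hs" "i \<noteq> j"
    then show "edges (Hs ! i) \<inter> edges (Hs ! j) = {}" using Es(3) by (simp add: Hs_def)
  next
    show "(\<Union>H\<in>set Hs. edges H) = edges G" using Es(2) by (simp add: Hs_def)
  qed
  ultimately show ?thesis by (rule that)
qed

text \<open>All graphs are realised jointly, as one list, to make their edge sets disjoint; the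
  result is then cut back into the four groups.\<close>

lemma realise_parts:
  assumes Ms: "\<forall>M\<in>set Ms. M \<subseteq> pairs (verts G) \<and> (\<forall>v\<in>verts G. vdeg M v = 1)"
    and Cs: "\<forall>C\<in>set Cs. ham (verts G) C"
    and S: "S \<subseteq> pairs (verts G)" "\<forall>v\<in>verts G. vdeg S v = a"
    and Ts: "\<forall>T\<in>set Ts. T \<subseteq> pairs (verts G) \<and> (\<forall>v\<in>verts G. vdeg T v = b)"
    and m: "\<forall>p\<in>pairs (verts G). pair_mult p = cover (Ms @ Cs @ [S] @ Ts) p"
  shows "\<exists>Ms' Cs' S' Ts'. decomposition G (Ms' @ Cs' @ [S'] @ Ts') \<and>
    length Ms' = length Ms \<and> (\<forall>M\<in>set Ms'. perfect_matching M G) \<and>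
    length Cs' = length Cs \<and> (\<forall>C\<in>set Cs'. hamilton_cycle C G) \<and>
    spanning_subgraph S' G \<and> regular a S' \<and> simple S' \<and>
    length Ts' = length Ts \<and> (\<forall>T\<in>set Ts'. spanning_subgraph T G \<and> regular b T \<and> simple T)"
proof -
  have "P \<subseteq> pairs (verts G)" if P: "P \<in> set (Ms @ Cs @ [S] @ Ts)" for P
  proof -
    consider "P \<in> set Ms" | "P \<in> set Cs" | "P = S" | "P \<in> set Ts" using P by auto
    then show ?thesis
      by cases (use Ms S Ts Cs ham_facts(1)[OF _ finite_verts] in blast)+
  qed
  then obtain Hs where Hs: "list_all2 realises Hs (Ms @ Cs @ [S] @ Ts)" "decomposition G Hs"
    using realise_decomposition m by metis
  then obtain Ms' Cs' S' Ts' where parts: "Hs = Ms' @ Cs' @ [S'] @ Ts'" "list_all2 realises Ms' Ms"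
    "list_all2 realises Cs' Cs" "realises S' S" "list_all2 realises Ts' Ts"
    by (auto simp: list_all2_append2 list_all2_Cons2)
  have ex: "\<exists>P\<in>set Ps. realises H P" if "list_all2 realises Hs Ps" "H \<in> set Hs" for Hs Ps H
    using that by (metis in_set_conv_nth list_all2_conv_all_nth)
  show ?thesis
  proof (intro exI conjI ballI)
    show "decomposition G (Ms' @ Cs' @ [S'] @ Ts')" using Hs parts(1) by simp
    show "length Ms' = length Ms" "length Cs' = length Cs" "length Ts' = length Ts"
      using parts list_all2_lengthD by blast+
    show "perfect_matching M G" if "M \<in> set Ms'" for M
      using ex[OF parts(2) that] realises_matching Ms by blast
    show "hamilton_cycle C G" if "C \<in> set Cs'" for C
      using ex[OF parts(3) that] realises_hamilton Cs by blast
    show "spanning_subgraph S' G" "regular a S'" "simple S'"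
      using realises_spanning[OF parts(4)] realises_regular[OF parts(4) S(2)]
        realises_simple[OF parts(4)] by auto
    show "spanning_subgraph T G" "regular b T" "simple T" if "T \<in> set Ts'" for T
      using ex[OF parts(5) that] realises_spanning realises_regular realises_simple Ts by blast+
  qed
qed

lemma pair_mult_le:
  assumes "p \<in> pairs (verts G)"
  shows "pair_mult p \<le> max_multiplicity G"
proof -
  obtain u v where uv: "p = {u, v}" "u \<in> verts G" "v \<in> verts G" "u \<noteq> v"
    using assms by (rule pairsE)
  let ?M = "{multiplicity G u v | u v. u \<in> verts G \<and> v \<in> verts G \<and> u \<noteq> v}"
  have "?M \<subseteq> (\<lambda>(u, v). multiplicity G u v) ` (verts G \<times> verts G)" by auto
  then have "finite ?M" using finite_verts by (meson finite_SigmaI finite_imageI finite_subset)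
  moreover have "pair_mult p \<in> ?M" using uv by (auto simp: pair_mult_def multiplicity_def)
  ultimately show ?thesis unfolding max_multiplicity_def by (rule Max_ge)
qed

lemma mdeg_pair_mult: "mdeg (verts G) pair_mult v = degree G v"
proof -
  let ?S = "{p. p \<in> pairs (verts G) \<and> v \<in> p}"
  have "{e \<in> edges G. v \<in> ends G e} = (\<Union>p\<in>?S. {e \<in> edges G. ends G e = p})"
    using ends_in_pairs by auto
  moreover have "card \<dots> = (\<Sum>p\<in>?S. card {e \<in> edges G. ends G e = p})"
    using finite_pairs[OF finite_verts] finite_edges by (intro card_UN_disjoint) auto
  ultimately show ?thesis by (simp add: mdeg_def degree_def pair_mult_def)
qed

end

theorem lemma3p2:
  fixes G :: "('v, 'e) pre_multigraph" and k n r :: nat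
  assumes "multigraph G"
    and "regular k G"
    and "order G = n" and "even n" and "n \<ge> 96"
    and "max_multiplicity G = r" and "odd r" and "r \<ge> 3"
  shows "(\<forall>s::nat. even s \<and> k = r * s \<and> real k \<ge> real r * (real n / 2 + 16) \<longrightarrow>
      (\<exists>Ms Cs S Ts. decomposition G (Ms @ Cs @ [S] @ Ts) \<and>
         length Ms = r - 2 \<and> (\<forall>M \<in> set Ms. perfect_matching M G) \<and>
         length Cs = (r + 1) div 2 \<and> (\<forall>C \<in> set Cs. hamilton_cycle C G) \<and>
         spanning_subgraph S G \<and> regular (s - 1) S \<and> simple S \<and>
         length Ts = r - 1 \<and>
         (\<forall>T \<in> set Ts. spanning_subgraph T G \<and> regular (s - 2) T \<and> simple T)))
    \<and> (\<forall>s::nat. odd s \<and> k = r * s \<and> real k \<ge> real r * (real n / 2 + 17) \<longrightarrow>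
      (\<exists>Ms Cs S Ts. decomposition G (Ms @ Cs @ [S] @ Ts) \<and>
         length Ms = 2 * r - 2 \<and> (\<forall>M \<in> set Ms. perfect_matching M G) \<and>
         length Cs = (r + 1) div 2 \<and> (\<forall>C \<in> set Cs. hamilton_cycle C G) \<and>
         spanning_subgraph S G \<and> regular (s - 2) S \<and> simple S \<and>
         length Ts = r - 1 \<and>
         (\<forall>T \<in> set Ts. spanning_subgraph T G \<and> regular (s - 3) T \<and> simple T)))"
proof -
  interpret multigraph G by fact
  note fin = finite_verts
  have ev: "even (card (verts G))" and n3: "3 \<le> card (verts G)"
    using assms(3-5) by (auto simp: order_def)
  have m: "\<forall>p\<in>pairs (verts G). pair_mult p \<le> r"
    using pair_mult_le assms(6) by simp
  have deg: "mdeg (verts G) pair_mult v = k" if "v \<in> verts G" for v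
    using assms(2) that by (simp add: mdeg_pair_mult regular_def)
  have bound: "real n / 2 + c \<le> real s"
    if "k = r * s" "real k \<ge> real r * (real n / 2 + c)" for s and c :: real
    using that assms(8) by simp
  show ?thesis
  proof (intro conjI allI impI)
    fix s assume s: "even s \<and> k = r * s \<and> real k \<ge> real r * (real n / 2 + 16)"
    have deg': "\<forall>v\<in>verts G. mdeg (verts G) pair_mult v = r * s" using deg s by simp
    have "real n / 2 + 16 \<le> real s" using bound s by blast
    then have s': "card (verts G) + 32 \<le> 2 * s" using assms(3) by (simp add: order_def)
    from multiplicity_decomposition[OF fin ev n3 m assms(7,8) deg' s']
    obtain Ms Cs S Ts where *: "length Ms = r - 2"
      "\<forall>M\<in>set Ms. M \<subseteq> pairs (verts G) \<and> (\<forall>v\<in>verts G. vdeg M v = 1)"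
      "length Cs = (r + 1) div 2" "\<forall>C\<in>set Cs. ham (verts G) C"
      "S \<subseteq> pairs (verts G)" "\<forall>v\<in>verts G. vdeg S v = s - 1" "length Ts = r - 1"
      "\<forall>T\<in>set Ts. T \<subseteq> pairs (verts G) \<and> (\<forall>v\<in>verts G. vdeg T v = s - 2)"
      "\<forall>p\<in>pairs (verts G). pair_mult p = cover (Ms @ Cs @ [S] @ Ts) p"
      by (elim exE conjE) (rule that)
    show "\<exists>Ms Cs S Ts. decomposition G (Ms @ Cs @ [S] @ Ts) \<and>
         length Ms = r - 2 \<and> (\<forall>M \<in> set Ms. perfect_matching M G) \<and>
         length Cs = (r + 1) div 2 \<and> (\<forall>C \<in> set Cs. hamilton_cycle C G) \<and>
         spanning_subgraph S G \<and> regular (s - 1) S \<and> simple S \<and>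
         length Ts = r - 1 \<and>
         (\<forall>T \<in> set Ts. spanning_subgraph T G \<and> regular (s - 2) T \<and> simple T)"
      using realise_parts[OF *(2,4,5,6,8,9)] unfolding *(1,3,7) .
  next
    fix s assume s: "odd s \<and> k = r * s \<and> real k \<ge> real r * (real n / 2 + 17)"
    have deg': "\<forall>v\<in>verts G. mdeg (verts G) pair_mult v = r * s" using deg s by simp
    have "real n / 2 + 17 \<le> real s" using bound s by blast
    then have s': "card (verts G) + 34 \<le> 2 * s" using assms(3) by (simp add: order_def)
    from multiplicity_decomposition_more_matchings[OF fin ev n3 m assms(7,8) deg' s']
    obtain Ms Cs S Ts where *: "length Ms = 2 * r - 2"
      "\<forall>M\<in>set Ms. M \<subseteq> pairs (verts G) \<and> (\<forall>v\<in>verts G. vdeg M v = 1)"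
      "length Cs = (r + 1) div 2" "\<forall>C\<in>set Cs. ham (verts G) C"
      "S \<subseteq> pairs (verts G)" "\<forall>v\<in>verts G. vdeg S v = s - 2" "length Ts = r - 1"
      "\<forall>T\<in>set Ts. T \<subseteq> pairs (verts G) \<and> (\<forall>v\<in>verts G. vdeg T v = s - 3)"
      "\<forall>p\<in>pairs (verts G). pair_mult p = cover (Ms @ Cs @ [S] @ Ts) p"
      by (elim exE conjE) (rule that)
    show "\<exists>Ms Cs S Ts. decomposition G (Ms @ Cs @ [S] @ Ts) \<and>
         length Ms = 2 * r - 2 \<and> (\<forall>M \<in> set Ms. perfect_matching M G) \<and>
         length Cs = (r + 1) div 2 \<and> (\<forall>C \<in> set Cs. hamilton_cycle C G) \<and>
         spanning_subgraph S G \<and> regular (s - 2) S \<and> simple S \<and>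
         length Ts = r - 1 \<and>
         (\<forall>T \<in> set Ts. spanning_subgraph T G \<and> regular (s - 3) T \<and> simple T)"
      using realise_parts[OF *(2,4,5,6,8,9)] unfolding *(1,3,7) .
  qed
qed

end
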